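(* Let $n\in\mathbb{N}$. For $\sigma\in\mathfrak{D}_n$ write $\sigma=\xi_k\cdots\xi_1$ with each $\xi_j\in\{\tau_i,\bar\tau_i:i=1,\dots,n-1\}$ and set $\mathcal{P}_\sigma=\mathcal{P}_{\xi_k}\cdots\mathcal{P}_{\xi_1}$. Then $\mathcal{P}_\sigma:\mathcal{C}^n(\mathbb{R})\to\mathcal{C}^n(\mathbb{R})$ is well defined (independent of the decomposition of $\sigma$), and $\sigma\mapsto\mathcal{P}_\sigma$ is a monoid isomorphism from the biHecke monoid $\mathfrak{D}_n$ onto the monoid (under composition) generated by the maps $\mathcal{P}_{\tau_i},\mathcal{P}_{\bar\tau_i}$. Moreover, letting $\lambda:\mathcal{C}^n(\mathbb{R})\to\mathbb{R}^n$ denote the slope map, for every $\sigma\in\mathfrak{D}_n$, $$\lambda\circ\mathcal{P}_\sigma=\sigma\circ\lambda,$$ where on the right-hand side $\sigma$ acts on $\mathbb{R}^n$ through the basic action.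
   Context: biHecke monoid. Let $S_n$ be the symmetric group and $\pi_i=(i,i+1)$. Define functions $\tau_i,\bar\tau_i:S_n\to S_n$, $1\le i\le n-1$, by $\tau_i(\chi)=\chi$ if $\chi^{-1}(i)>\chi^{-1}(i+1)$ and $\tau_i(\chi)=\pi_i\chi$ if $\chi^{-1}(i)<\chi^{-1}(i+1)$; $\bar\tau_i(\chi)=\chi$ if $\chi^{-1}(i)<\chi^{-1}(i+1)$ and $\bar\tau_i(\chi)=\pi_i\chi$ if $\chi^{-1}(i)>\chi^{-1}(i+1)$. $\mathfrak{D}_n$ is the submonoid, under composition, of the monoid of all functions $S_n\to S_n$ generated by the $\tau_i,\bar\tau_i$. Basic action. $\mathfrak{D}_n$ acts on $\mathbb{R}^n$ (the basic action) as follows: $\tau_i$ acts by swapping coordinates $i,i+1$ of $x$ if $x_i<x_{i+1}$ and fixing $x$ otherwise; $\bar\tau_i$ acts by swapping coordinates $i,i+1$ if $x_i>x_{i+1}$ and fixing $x$ otherwise. These extend to an action of $\mathfrak{D}_n$. Pitman operators. $\mathcal{C}^n(\mathbb{R})$ is the set of continuous $f:\mathbb{R}\to\mathbb{R}^n$ for which the slope $\lambda(f)=\lim_{x\to\pm\infty}f(x)/x\in\mathbb{R}^n$ exists. For $f\in\mathcal{C}^2(\mathbb{R})$, $\mathcal{P}f=f$ if $\lambda_1(f)\ge\lambda_2(f)$; if $\lambda_1(f)<\lambda_2(f)$ then $\mathcal{P}f_1(x)=f_1(x)+\sup_{z\le x}[f_2(z)-f_1(z)]$, $\mathcal{P}f_2(x)=f_2(x)-\sup_{z\le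 x}[f_2(z)-f_1(z)]$. On $\mathcal{C}^n(\mathbb{R})$, $\mathcal{P}_{\tau_i}f=(f_1,\dots,f_{i-1},\mathcal{P}(f_i,f_{i+1}),f_{i+2},\dots,f_n)$ and $\mathcal{P}_{\bar\tau_i}=R\mathcal{P}_{\tau_i}R$, where $Rf(x)=f(-x)$. *)

theory Defs
  imports Complex_Main "HOL-Combinatorics.Permutations" "HOL-Algebra.Group"
begin

unbundle no m_inv_syntax

section \<open>Generated submonoids and words\<close>

text \<open>All self-maps of \<open>S\<close>. As for \<^const>\<open>compose\<close> and \<^const>\<open>PiE\<close> in general, maps are
  extensional, so that equality in the monoid is equality of functions on \<open>S\<close>.\<close>

definition fun_monoid :: "'a set \<Rightarrow> ('a \<Rightarrow> 'a) monoid" where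
  "fun_monoid S = \<lparr>carrier = S \<rightarrow>\<^sub>E S, mult = compose S, one = (\<lambda>x\<in>S. x)\<rparr>"

inductive_set gen_submonoid :: "('a, 'b) monoid_scheme \<Rightarrow> 'a set \<Rightarrow> 'a set"
  for G and A where
    one: "\<one>\<^bsub>G\<^esub> \<in> gen_submonoid G A"
  | incl: "a \<in> A \<Longrightarrow> a \<in> gen_submonoid G A"
  | mult: "a \<in> gen_submonoid G A \<Longrightarrow> b \<in> gen_submonoid G A \<Longrightarrow> a \<otimes>\<^bsub>G\<^esub> b \<in> gen_submonoid G A"

datatype gen = Tau nat | TauBar nat

definition gens :: "nat \<Rightarrow> gen set" where
  "gens n = Tau ` {1..<n} \<union> TauBar ` {1..<n}"

text \<open>The list \<open>[\<xi>\<^sub>k, \<dots>, \<xi>\<^sub>1]\<close> is the word \<open>\<xi>\<^sub>k \<cdots> \<xi>\<^sub>1\<close>; its last letter acts first.\<close>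

definition eval_word :: "('a, 'b) monoid_scheme \<Rightarrow> (gen \<Rightarrow> 'a) \<Rightarrow> gen list \<Rightarrow> 'a" where
  "eval_word G \<phi> w = foldr (\<lambda>\<xi> a. \<phi> \<xi> \<otimes>\<^bsub>G\<^esub> a) w \<one>\<^bsub>G\<^esub>"

lemma eval_word_Nil [simp]: "eval_word G \<phi> [] = \<one>\<^bsub>G\<^esub>"
  and eval_word_Cons [simp]: "eval_word G \<phi> (\<xi> # w) = \<phi> \<xi> \<otimes>\<^bsub>G\<^esub> eval_word G \<phi> w"
  by (simp_all add: eval_word_def)


section \<open>The biHecke monoid\<close>

definition Sym :: "nat \<Rightarrow> (nat \<Rightarrow> nat) set" where
  "Sym n = {\<chi>. \<chi> permutes {1..n}}"

fun biHecke_gen :: "nat \<Rightarrow> gen \<Rightarrow> (nat \<Rightarrow> nat) \<Rightarrow> (nat \<Rightarrow> nat)" where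
  "biHecke_gen n (Tau i) = (\<lambda>\<chi>\<in>Sym n.
     if inv \<chi> i < inv \<chi> (i + 1) then Transposition.transpose i (i + 1) \<circ> \<chi> else \<chi>)"
| "biHecke_gen n (TauBar i) = (\<lambda>\<chi>\<in>Sym n.
     if inv \<chi> i > inv \<chi> (i + 1) then Transposition.transpose i (i + 1) \<circ> \<chi> else \<chi>)"

definition biHecke :: "nat \<Rightarrow> ((nat \<Rightarrow> nat) \<Rightarrow> (nat \<Rightarrow> nat)) monoid" where
  "biHecke n = (fun_monoid (Sym n))
     \<lparr>carrier := gen_submonoid (fun_monoid (Sym n)) (biHecke_gen n ` gens n)\<rparr>"

abbreviation biHecke_word :: "nat \<Rightarrow> gen list \<Rightarrow> (nat \<Rightarrow> nat) \<Rightarrow> (nat \<Rightarrow> nat)" where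
  "biHecke_word n \<equiv> eval_word (fun_monoid (Sym n)) (biHecke_gen n)"

text \<open>An arbitrary decomposition of \<open>\<sigma>\<close> into generators; one exists for every \<open>\<sigma>\<close> in the biHecke
  monoid by \<open>biHecke_carrier\<close> below.\<close>

definition word_of :: "nat \<Rightarrow> ((nat \<Rightarrow> nat) \<Rightarrow> (nat \<Rightarrow> nat)) \<Rightarrow> gen list" where
  "word_of n \<sigma> = (SOME w. w \<in> lists (gens n) \<and> biHecke_word n w = \<sigma>)"


section \<open>The basic action\<close>

definition Rvec :: "nat \<Rightarrow> (nat \<Rightarrow> real) set" where
  "Rvec n = {1..n} \<rightarrow>\<^sub>E UNIV"

fun basic_gen :: "nat \<Rightarrow> gen \<Rightarrow> (nat \<Rightarrow> real) \<Rightarrow> (nat \<Rightarrow> real)" where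
  "basic_gen n (Tau i) = (\<lambda>x\<in>Rvec n.
     if x i < x (i + 1) then x(i := x (i + 1), i + 1 := x i) else x)"
| "basic_gen n (TauBar i) = (\<lambda>x\<in>Rvec n.
     if x i > x (i + 1) then x(i := x (i + 1), i + 1 := x i) else x)"

abbreviation basic_word :: "nat \<Rightarrow> gen list \<Rightarrow> (nat \<Rightarrow> real) \<Rightarrow> (nat \<Rightarrow> real)" where
  "basic_word n \<equiv> eval_word (fun_monoid (Rvec n)) (basic_gen n)"

text \<open>Independent of the chosen word, see \<open>basic_action_word\<close> below.\<close>

definition basic_action ::
    "nat \<Rightarrow> ((nat \<Rightarrow> nat) \<Rightarrow> (nat \<Rightarrow> nat)) \<Rightarrow> (nat \<Rightarrow> real) \<Rightarrow> (nat \<Rightarrow> real)" where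
  "basic_action n \<sigma> = basic_word n (word_of n \<sigma>)"


section \<open>Pitman operators\<close>

definition is_slope :: "nat \<Rightarrow> (real \<Rightarrow> nat \<Rightarrow> real) \<Rightarrow> (nat \<Rightarrow> real) \<Rightarrow> bool" where
  "is_slope n f l \<longleftrightarrow> l \<in> Rvec n \<and>
     (\<forall>i\<in>{1..n}. ((\<lambda>x. f x i / x) \<longlongrightarrow> l i) at_top \<and> ((\<lambda>x. f x i / x) \<longlongrightarrow> l i) at_bot)"

definition slope :: "nat \<Rightarrow> (real \<Rightarrow> nat \<Rightarrow> real) \<Rightarrow> nat \<Rightarrow> real" where
  "slope n f = (THE l. is_slope n f l)"

definition paths :: "nat \<Rightarrow> (real \<Rightarrow> nat \<Rightarrow> real) set" where
  "paths n = {f. (\<forall>x. f x \<in> Rvec n) \<and> (\<forall>i\<in>{1..n}. continuous_on UNIV (\<lambda>x. f x i)) \<and>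
     (\<exists>l. is_slope n f l)}"

text \<open>The two components of a path are its coordinates 1 and 2. In the second case the supremum is over
  a set bounded above, since \<open>f z 2 - f z 1\<close> tends to \<open>-\<infinity>\<close> as \<open>z\<close> tends to \<open>-\<infinity>\<close>.\<close>

definition pitman :: "(real \<Rightarrow> nat \<Rightarrow> real) \<Rightarrow> real \<Rightarrow> nat \<Rightarrow> real" where
  "pitman f = (if slope 2 f 1 \<ge> slope 2 f 2 then f
     else (\<lambda>x. (f x)(1 := f x 1 + (SUP z\<in>{..x}. f z 2 - f z 1),
                     2 := f x 2 - (SUP z\<in>{..x}. f z 2 - f z 1))))"

definition pair_at :: "nat \<Rightarrow> (real \<Rightarrow> nat \<Rightarrow> real) \<Rightarrow> real \<Rightarrow> nat \<Rightarrow> real" where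
  "pair_at i f = (\<lambda>x. (\<lambda>_. undefined)(1 := f x i, 2 := f x (i + 1)))"

definition reflect :: "(real \<Rightarrow> nat \<Rightarrow> real) \<Rightarrow> real \<Rightarrow> nat \<Rightarrow> real" where
  "reflect f = (\<lambda>x. f (- x))"

definition pitman_at :: "nat \<Rightarrow> (real \<Rightarrow> nat \<Rightarrow> real) \<Rightarrow> real \<Rightarrow> nat \<Rightarrow> real" where
  "pitman_at i f = (\<lambda>x. (f x)(i := pitman (pair_at i f) x 1, i + 1 := pitman (pair_at i f) x 2))"

fun pitman_gen :: "nat \<Rightarrow> gen \<Rightarrow> (real \<Rightarrow> nat \<Rightarrow> real) \<Rightarrow> (real \<Rightarrow> nat \<Rightarrow> real)" where
  "pitman_gen n (Tau i) = (\<lambda>f\<in>paths n. pitman_at i f)"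
| "pitman_gen n (TauBar i) = (\<lambda>f\<in>paths n. reflect (pitman_at i (reflect f)))"

abbreviation pitman_word :: "nat \<Rightarrow> gen list \<Rightarrow> (real \<Rightarrow> nat \<Rightarrow> real) \<Rightarrow> (real \<Rightarrow> nat \<Rightarrow> real)" where
  "pitman_word n \<equiv> eval_word (fun_monoid (paths n)) (pitman_gen n)"

definition Pitman_monoid :: "nat \<Rightarrow> ((real \<Rightarrow> nat \<Rightarrow> real) \<Rightarrow> (real \<Rightarrow> nat \<Rightarrow> real)) monoid" where
  "Pitman_monoid n = (fun_monoid (paths n))
     \<lparr>carrier := gen_submonoid (fun_monoid (paths n)) (pitman_gen n ` gens n)\<rparr>"

definition Pitman ::
    "nat \<Rightarrow> ((nat \<Rightarrow> nat) \<Rightarrow> (nat \<Rightarrow> nat)) \<Rightarrow> (real \<Rightarrow> nat \<Rightarrow> real) \<Rightarrow> (real \<Rightarrow> nat \<Rightarrow> real)" where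
  "Pitman n \<sigma> = pitman_word n (word_of n \<sigma>)"


section \<open>Well-definedness of the notions above\<close>

lemma monoid_fun_monoid: "monoid (fun_monoid S)"
proof (rule monoidI)
  fix f g h assume "f \<in> carrier (fun_monoid S)" "g \<in> carrier (fun_monoid S)" "h \<in> carrier (fun_monoid S)"
  then show "f \<otimes>\<^bsub>fun_monoid S\<^esub> g \<otimes>\<^bsub>fun_monoid S\<^esub> h = f \<otimes>\<^bsub>fun_monoid S\<^esub> (g \<otimes>\<^bsub>fun_monoid S\<^esub> h)"
    by (auto simp: fun_monoid_def compose_def fun_eq_iff PiE_def)
qed (auto simp: fun_monoid_def compose_def PiE_def extensional_def fun_eq_iff)

lemma submonoid_gen_submonoid:
  assumes "monoid G" and "A \<subseteq> carrier G"
  shows "submonoid (gen_submonoid G A) G"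
proof
  show "gen_submonoid G A \<subseteq> carrier G"
  proof
    fix x assume "x \<in> gen_submonoid G A"
    then show "x \<in> carrier G"
      by induction (use assms in \<open>auto simp: monoid.m_closed\<close>)
  qed
qed (auto intro: gen_submonoid.intros)

lemma gen_submonoid_words:
  assumes "monoid G" and "\<phi> ` S \<subseteq> carrier G"
  shows "gen_submonoid G (\<phi> ` S) = eval_word G \<phi> ` lists S"
proof
  interpret monoid G by fact
  have cl: "eval_word G \<phi> w \<in> carrier G" if "w \<in> lists S" for w
    using that by induction (use assms in auto)
  have app: "eval_word G \<phi> (v @ w) = eval_word G \<phi> v \<otimes>\<^bsub>G\<^esub> eval_word G \<phi> w"
    if v: "v \<in> lists S" and w: "w \<in> lists S" for v w
    using v
  proof induction
    case Nil
    then show ?case using w cl by simp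
  next
    case (Cons s v)
    then have "\<phi> s \<in> carrier G" using assms(2) by auto
    with Cons.IH show ?case
      using cl[OF w] cl[OF Cons.hyps(2)] by (simp add: m_assoc)
  qed
  show "gen_submonoid G (\<phi> ` S) \<subseteq> eval_word G \<phi> ` lists S"
  proof
    fix x assume "x \<in> gen_submonoid G (\<phi> ` S)"
    then show "x \<in> eval_word G \<phi> ` lists S"
    proof induction
      case one
      then show ?case by (intro image_eqI[of _ _ "[]"]) auto
    next
      case (incl a)
      then obtain s where "s \<in> S" "a = \<phi> s" by auto
      then show ?case using assms by (intro image_eqI[of _ _ "[s]"]) auto
    next
      case (mult a b)
      then obtain v w where "v \<in> lists S" "w \<in> lists S" "a = eval_word G \<phi> v" "b = eval_word G \<phi> w"
        by auto
      then show ?case by (intro image_eqI[of _ _ "v @ w"]) (auto simp: app)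
    qed
  qed
  show "eval_word G \<phi> ` lists S \<subseteq> gen_submonoid G (\<phi> ` S)"
  proof (rule image_subsetI)
    fix w assume "w \<in> lists S"
    then show "eval_word G \<phi> w \<in> gen_submonoid G (\<phi> ` S)"
      by induction (auto intro: gen_submonoid.intros)
  qed
qed

lemma biHecke_gen_closed:
  assumes "\<xi> \<in> gens n"
  shows "biHecke_gen n \<xi> \<in> Sym n \<rightarrow>\<^sub>E Sym n"
proof -
  have "Transposition.transpose i (Suc i) \<circ> \<chi> permutes {1..n}"
    if "i \<in> {1..<n}" "\<chi> permutes {1..n}" for i \<chi>
    using that by (intro permutes_compose permutes_swap_id) auto
  then show ?thesis
    using assms by (auto simp: gens_def Sym_def)
qed

lemma monoid_biHecke: "monoid (biHecke n)"
proof -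
  have "submonoid (carrier (biHecke n)) (fun_monoid (Sym n))"
    using submonoid_gen_submonoid[OF monoid_fun_monoid, of "biHecke_gen n ` gens n" "Sym n"]
      biHecke_gen_closed
    by (auto simp: biHecke_def fun_monoid_def)
  then have "monoid ((fun_monoid (Sym n))\<lparr>carrier := carrier (biHecke n)\<rparr>)"
    by (rule submonoid.submonoid_is_monoid) (rule monoid_fun_monoid)
  then show ?thesis by (simp add: biHecke_def)
qed

lemma biHecke_carrier: "carrier (biHecke n) = biHecke_word n ` lists (gens n)"
  using gen_submonoid_words[OF monoid_fun_monoid, of "biHecke_gen n" "gens n" "Sym n"]
    biHecke_gen_closed
  by (auto simp: biHecke_def fun_monoid_def)

lemma word_of:
  assumes "\<sigma> \<in> carrier (biHecke n)"
  shows "word_of n \<sigma> \<in> lists (gens n)" and "biHecke_word n (word_of n \<sigma>) = \<sigma>"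
  using assms someI_ex[of "\<lambda>w. w \<in> lists (gens n) \<and> biHecke_word n w = \<sigma>"]
  unfolding word_of_def biHecke_carrier by auto

lemma is_slope_unique:
  assumes "is_slope n f l" and "is_slope n f l'"
  shows "l = l'"
proof (rule PiE_ext)
  show "l \<in> {1..n} \<rightarrow>\<^sub>E UNIV" "l' \<in> {1..n} \<rightarrow>\<^sub>E UNIV"
    using assms by (auto simp: is_slope_def Rvec_def)
  show "l i = l' i" if "i \<in> {1..n}" for i
    using assms that tendsto_unique[OF trivial_limit_at_top_linorder]
    by (fastforce simp: is_slope_def)
qed

lemma is_slope_slope:
  assumes "f \<in> paths n"
  shows "is_slope n f (slope n f)"
proof -
  obtain l where "is_slope n f l" using assms by (auto simp: paths_def)
  moreover from this have "slope n f = l"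
    unfolding slope_def by (intro the_equality is_slope_unique)
  ultimately show ?thesis by simp
qed

text \<open>Every vector is \<open>x = y \<circ> \<chi>\<inverse>\<close> with \<open>y\<close> weakly increasing and \<open>\<chi>\<close> a permutation, and in this form
  the basic action is the action of the biHecke monoid on \<open>\<chi>\<close>.\<close>

lemma ex_sorting_permutation:
  fixes x :: "nat \<Rightarrow> real"
  shows "\<exists>\<chi>\<in>Sym n. \<forall>i\<in>{1..n}. \<forall>j\<in>{1..n}. i \<le> j \<longrightarrow> x (\<chi> i) \<le> x (\<chi> j)"
proof -
  define less where "less i j \<longleftrightarrow> x i < x j \<or> x i = x j \<and> i < j" for i j :: nat
  define r where "r i = (if i \<in> {1..n} then card {j\<in>{1..n}. j = i \<or> less j i} else i)" for i
  have r_mono: "r i < r j" if "i \<in> {1..n}" "j \<in> {1..n}" "less i j" for i j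
  proof -
    have "{k\<in>{1..n}. k = i \<or> less k i} \<subset> {k\<in>{1..n}. k = j \<or> less k j}"
      using that by (auto simp: less_def)
    then have "card {k\<in>{1..n}. k = i \<or> less k i} < card {k\<in>{1..n}. k = j \<or> less k j}"
      by (intro psubset_card_mono) simp_all
    then show ?thesis using that by (simp add: r_def)
  qed
  have tot: "less i j \<or> i = j \<or> less j i" for i j by (auto simp: less_def)
  have inj: "inj_on r {1..n}"
    by (rule inj_onI) (metis tot r_mono less_irrefl)
  have "r i \<in> {1..n}" if "i \<in> {1..n}" for i
  proof -
    have "card {j\<in>{1..n}. j = i \<or> less j i} \<le> card {1..n}"
      by (intro card_mono) auto
    moreover have "card {j\<in>{1..n}. j = i \<or> less j i} > 0"
      using that by (subst card_gt_0_iff) auto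
    ultimately show ?thesis using that unfolding r_def by simp
  qed
  then have "r ` {1..n} \<subseteq> {1..n}" by auto
  with inj have "bij_betw r {1..n} {1..n}"
    by (simp add: bij_betw_def endo_inj_surj)
  then have perm: "r permutes {1..n}"
    by (rule bij_imp_permutes) (simp only: r_def if_False)
  have "x (inv r i) \<le> x (inv r j)" if "i \<in> {1..n}" "j \<in> {1..n}" "i \<le> j" for i j
  proof (rule ccontr)
    assume "\<not> ?thesis"
    then have "less (inv r j) (inv r i)" by (auto simp: less_def)
    moreover have "inv r i \<in> {1..n}" "inv r j \<in> {1..n}"
      using that permutes_in_image[OF permutes_inv[OF perm]] by auto
    ultimately have "r (inv r j) < r (inv r i)" by (intro r_mono)
    then show False using that by (simp add: permutes_inverses[OF perm])
  qed
  then show ?thesis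
    using permutes_inv[OF perm] by (auto simp: Sym_def)
qed

lemma basic_gen_sorted:
  assumes \<xi>: "\<xi> \<in> gens n" and \<chi>: "\<chi> \<in> Sym n"
    and y: "y \<in> Rvec n" "\<And>i j. i \<in> {1..n} \<Longrightarrow> j \<in> {1..n} \<Longrightarrow> i \<le> j \<Longrightarrow> y i \<le> y j"
  shows "basic_gen n \<xi> (y \<circ> inv \<chi>) = y \<circ> inv (biHecke_gen n \<xi> \<chi>)"
proof -
  obtain i where i: "i \<in> {1..<n}" and \<xi>_cases: "\<xi> = Tau i \<or> \<xi> = TauBar i"
    using \<xi> by (auto simp: gens_def)
  let ?t = "Transposition.transpose i (i + 1)"
  have p: "\<chi> permutes {1..n}" and pinv: "inv \<chi> permutes {1..n}"
    using \<chi> by (auto simp: Sym_def permutes_inv)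
  have in_R: "y \<circ> inv \<chi> \<in> Rvec n"
    using y(1) permutes_not_in[OF pinv] by (auto simp: Rvec_def PiE_def extensional_def)
  have range: "inv \<chi> i \<in> {1..n}" "inv \<chi> (i + 1) \<in> {1..n}"
    using i permutes_in_image[OF pinv] by auto
  have neq: "inv \<chi> i \<noteq> inv \<chi> (i + 1)"
    by (simp add: inj_eq[OF permutes_inj[OF pinv]])
  have le: "inv \<chi> i < inv \<chi> (i + 1) \<Longrightarrow> y (inv \<chi> i) \<le> y (inv \<chi> (i + 1))"
    "inv \<chi> i > inv \<chi> (i + 1) \<Longrightarrow> y (inv \<chi> i) \<ge> y (inv \<chi> (i + 1))"
    using y(2) range by auto
  have "inv (?t \<circ> \<chi>) = inv \<chi> \<circ> ?t"
    by (subst o_inv_distrib) (auto simp: permutes_bij[OF p])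
  then have swap: "y \<circ> inv (?t \<circ> \<chi>) =
      (y \<circ> inv \<chi>)(i := y (inv \<chi> (i + 1)), i + 1 := y (inv \<chi> i))"
    by (auto simp: fun_eq_iff Transposition.transpose_def)
  have noswap: "(y \<circ> inv \<chi>)(i := y (inv \<chi> (i + 1)), i + 1 := y (inv \<chi> i)) = y \<circ> inv \<chi>"
    if "y (inv \<chi> i) = y (inv \<chi> (i + 1))"
    using that by (auto simp: fun_eq_iff)
  show ?thesis
    using \<xi>_cases
  proof
    assume "\<xi> = Tau i"
    with in_R \<chi> neq le swap noswap show ?thesis
      by (cases "inv \<chi> i < inv \<chi> (i + 1)";
          cases "y (inv \<chi> i) = y (inv \<chi> (i + 1))") auto
  next
    assume "\<xi> = TauBar i"
    with in_R \<chi> neq le swap noswap show ?thesis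
      by (cases "inv \<chi> i < inv \<chi> (i + 1)";
          cases "y (inv \<chi> i) = y (inv \<chi> (i + 1))") auto
  qed
qed

lemma basic_word_sorted:
  assumes w: "w \<in> lists (gens n)" and \<chi>: "\<chi> \<in> Sym n"
    and y: "y \<in> Rvec n" "\<And>i j. i \<in> {1..n} \<Longrightarrow> j \<in> {1..n} \<Longrightarrow> i \<le> j \<Longrightarrow> y i \<le> y j"
  shows "biHecke_word n w \<chi> \<in> Sym n \<and> basic_word n w (y \<circ> inv \<chi>) = y \<circ> inv (biHecke_word n w \<chi>)"
proof -
  have in_R: "y \<circ> inv \<chi> \<in> Rvec n"
    using y(1) \<chi> permutes_not_in[OF permutes_inv]
    by (fastforce simp: Sym_def Rvec_def PiE_def extensional_def)
  from w show ?thesis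
  proof induction
    case Nil
    have "basic_word n [] (y \<circ> inv \<chi>) = y \<circ> inv \<chi>"
      unfolding eval_word_Nil fun_monoid_def monoid.simps using in_R by (rule restrict_apply')
    moreover have "biHecke_word n [] \<chi> = \<chi>"
      using \<chi> by (simp add: fun_monoid_def)
    ultimately show ?case using \<chi> by argo
  next
    case (Cons \<xi> w)
    let ?\<chi> = "biHecke_word n w \<chi>"
    have 1: "biHecke_word n (\<xi> # w) \<chi> = biHecke_gen n \<xi> ?\<chi>"
      unfolding eval_word_Cons using \<chi> by (simp add: fun_monoid_def compose_eq)
    have "basic_word n (\<xi> # w) (y \<circ> inv \<chi>) = basic_gen n \<xi> (basic_word n w (y \<circ> inv \<chi>))"
      unfolding eval_word_Cons fun_monoid_def monoid.simps using in_R by (rule compose_eq)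
    also have "\<dots> = y \<circ> inv (biHecke_gen n \<xi> ?\<chi>)"
      using basic_gen_sorted[OF Cons.hyps(1) _ y] Cons.IH by metis
    finally show ?case
      unfolding 1 using Cons.IH biHecke_gen_closed[OF Cons.hyps(1)] by (auto simp only: PiE_mem)
  qed
qed

lemma basic_word_well_defined:
  assumes "v \<in> lists (gens n)" and "w \<in> lists (gens n)" and "biHecke_word n v = biHecke_word n w"
  shows "basic_word n v = basic_word n w"
proof
  fix x
  have ext: "basic_word n u \<in> extensional (Rvec n)" for u
    by (cases u) (auto simp: fun_monoid_def)
  show "basic_word n v x = basic_word n w x"
  proof (cases "x \<in> Rvec n")
    case True
    obtain \<chi> where \<chi>: "\<chi> \<in> Sym n" and
      sorted: "\<And>i j. i \<in> {1..n} \<Longrightarrow> j \<in> {1..n} \<Longrightarrow> i \<le> j \<Longrightarrow> (x \<circ> \<chi>) i \<le> (x \<circ> \<chi>) j"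
      using ex_sorting_permutation[of n x] by auto
    have p: "\<chi> permutes {1..n}" using \<chi> by (simp add: Sym_def)
    have "x \<circ> \<chi> \<in> Rvec n"
      using True permutes_not_in[OF p] by (auto simp: Rvec_def PiE_def extensional_def)
    note sorted_word = basic_word_sorted[OF _ \<chi> this sorted, THEN conjunct2]
    have "basic_word n v (x \<circ> \<chi> \<circ> inv \<chi>) = basic_word n w (x \<circ> \<chi> \<circ> inv \<chi>)"
      by (metis sorted_word assms)
    then show ?thesis by (simp add: o_assoc[symmetric] permutes_inv_o[OF p])
  next
    case False
    then show ?thesis using ext by (simp add: extensional_def)
  qed
qed

lemma basic_action_word:
  assumes "w \<in> lists (gens n)"
  shows "basic_action n (biHecke_word n w) = basic_word n w"
proof -
  have "biHecke_word n w \<in> carrier (biHecke n)"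
    using assms by (simp add: biHecke_carrier)
  from word_of[OF this] assms show ?thesis
    unfolding basic_action_def by (intro basic_word_well_defined)
qed

end

theory Submission
  imports Defs
begin

text \<open>Consider the operators \<open>P\<^sub>i\<close> of the \<open>\<tau>\<^sub>i\<close> at ascents of the slope vector, that is, where slope \<open>i\<close>
  is less than slope \<open>i + 1\<close>. There they commute when they act on disjoint pairs of coordinates
  and otherwise satisfy the braid relation, and each application removes one ascending pair of slopes; so, by
  Newman's lemma, every path has a unique sorted form, whose slopes are weakly decreasing. At an
  ascent, \<open>P\<^sub>i\<close> is inverted by its conjugate under time reversal. Hence all words preserve the sorted
  form, and a path is determined by its sorted form and its slopes. As the slopes transform by the
  basic action, the path that a word makes of \<open>f\<close> depends only on the element of the biHecke monoid.\<close>

section \<open>Running maxima\<close>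

definition running_max :: "(real \<Rightarrow> real) \<Rightarrow> real \<Rightarrow> real" where
  "running_max d x = (SUP z\<in>{..x}. d z)"

text \<open>On a set that is unbounded above, \<open>SUP\<close> over the reals carries no
  information. Decay at -\<infinity> bounds every set whose supremum \<open>running_max\<close>
  takes; continuity makes the running maximum continuous.\<close>

definition downward :: "(real \<Rightarrow> real) \<Rightarrow> bool" where
  "downward d \<longleftrightarrow> continuous_on UNIV d \<and> filterlim d at_bot at_bot"

lemma bdd_above_downward:
  assumes "downward d"
  shows "bdd_above (d ` {..x})"
proof -
  have "eventually (\<lambda>z. d z \<le> 0) at_bot"
    using assms by (auto simp: downward_def filterlim_at_bot)
  then obtain N where N: "\<And>z. z \<le> N \<Longrightarrow> d z \<le> 0"
    by (auto simp: eventually_at_bot_linorder)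
  have "continuous_on {N..max N x} d"
    using assms continuous_on_subset by (auto simp: downward_def)
  then obtain B where B: "\<And>z. z \<in> {N..max N x} \<Longrightarrow> d z \<le> B"
    using continuous_attains_sup[OF compact_Icc, of N "max N x" d]
    by (metis atLeastatMost_empty_iff max.cobounded1)
  have "d z \<le> max 0 B" if "z \<le> x" for z
    using N[of z] B[of z] that by (cases "z \<le> N") auto
  then show ?thesis by (auto simp: bdd_above_def)
qed

text \<open>Characterising the supremum by its upper bounds lets the later identities between nested
  suprema be proved by rearranging quantifiers.\<close>

lemma running_max_le_iff:
  assumes "downward d"
  shows "running_max d x \<le> c \<longleftrightarrow> (\<forall>z\<le>x. d z \<le> c)"
  unfolding running_max_def using bdd_above_downward[OF assms]
  by (subst cSUP_le_iff) auto

lemma le_running_max: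
  assumes "downward d" "z \<le> x"
  shows "d z \<le> running_max d x"
  using running_max_le_iff[OF assms(1), of x "running_max d x"] assms(2) by simp

lemma running_max_mono:
  assumes "downward d" "x \<le> y"
  shows "running_max d x \<le> running_max d y"
  using assms by (subst running_max_le_iff) (auto intro: le_running_max)

lemma running_max_le:
  assumes "downward d" "running_max d x \<le> c" "\<And>z. x \<le> z \<Longrightarrow> z \<le> y \<Longrightarrow> d z \<le> c"
  shows "running_max d y \<le> c"
  using assms by (auto simp: running_max_le_iff) (meson linear)

text \<open>Over a short interval the running maximum grows by at most the oscillation of d
  there.\<close>

lemma continuous_running_max:
  assumes d: "downward d"
  shows "continuous_on UNIV (running_max d)"
proof -
  have "\<exists>\<delta>>0. \<forall>y. \<bar>y - x\<bar> < \<delta> \<longrightarrow> \<bar>running_max d y - running_max d x\<bar> < \<epsilon>" if "\<epsilon> > 0" for x \<epsilon> :: real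
  proof -
    have "isCont d x" using d by (simp add: downward_def continuous_on_eq_continuous_at)
    then obtain \<delta> where "\<delta> > 0" and \<delta>': "\<And>z. z \<noteq> x \<Longrightarrow> \<bar>z - x\<bar> < \<delta> \<Longrightarrow> \<bar>d z - d x\<bar> < \<epsilon> / 4"
      using \<open>\<epsilon> > 0\<close> unfolding isCont_def LIM_eq real_norm_def
      by (metis divide_pos_pos zero_less_numeral)
    have \<delta>: "\<bar>d z - d x\<bar> < \<epsilon> / 4" if "\<bar>z - x\<bar> < \<delta>" for z
      using \<delta>'[of z] that \<open>\<epsilon> > 0\<close> by (cases "z = x") auto
    have "\<bar>running_max d y - running_max d x\<bar> < \<epsilon>" if y: "\<bar>y - x\<bar> < \<delta>" for y
    proof (cases "x \<le> y")
      case True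
      have "running_max d y \<le> running_max d x + \<epsilon> / 4"
      proof (rule running_max_le[OF d])
        fix z assume "x \<le> z" "z \<le> y"
        then show "d z \<le> running_max d x + \<epsilon> / 4"
          using \<delta>[of z] y True \<open>\<epsilon> > 0\<close> le_running_max[OF d order_refl, of x] by linarith
      qed (use that \<open>\<epsilon> > 0\<close> in auto)
      then show ?thesis
        using running_max_mono[OF d True] \<open>\<epsilon> > 0\<close> by auto
    next
      case False
      \<comment> \<open>Here d z and d y are compared through d x, which costs \<epsilon> / 4
        twice.\<close>
      have "running_max d x \<le> running_max d y + \<epsilon> / 2"
      proof (rule running_max_le[OF d])
        fix z assume "y \<le> z" "z \<le> x"
        then show "d z \<le> running_max d y + \<epsilon> / 2"
          using \<delta>[of z] \<delta>[of y] y False \<open>\<epsilon> > 0\<close> le_running_max[OF d order_refl, of y]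
          by linarith
      qed (use that \<open>\<epsilon> > 0\<close> in auto)
      then show ?thesis
        using running_max_mono[OF d, of y x] False \<open>\<epsilon> > 0\<close> by auto
    qed
    with \<open>\<delta> > 0\<close> show ?thesis by blast
  qed
  then have "isCont (running_max d) x" for x
    unfolding isCont_def LIM_eq real_norm_def by meson
  then show ?thesis by (simp add: continuous_on_eq_continuous_at)
qed

section \<open>Slopes of running maxima at both ends\<close>

lemma tendsto_iff_bounds:
  fixes f :: "real \<Rightarrow> real"
  shows "(f \<longlongrightarrow> m) F \<longleftrightarrow> (\<forall>\<epsilon>>0. eventually (\<lambda>x. m - \<epsilon> \<le> f x \<and> f x \<le> m + \<epsilon>) F)"
    (is "?L \<longleftrightarrow> ?R")
proof
  assume ?L
  show ?R
  proof (intro allI impI)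
    fix \<epsilon> :: real assume "\<epsilon> > 0"
    with \<open>?L\<close> have "eventually (\<lambda>x. dist (f x) m < \<epsilon>) F" by (rule tendstoD)
    then show "eventually (\<lambda>x. m - \<epsilon> \<le> f x \<and> f x \<le> m + \<epsilon>) F"
      by eventually_elim (auto simp: dist_real_def)
  qed
next
  assume R: ?R
  show ?L
  proof (rule tendstoI)
    fix \<epsilon> :: real assume "\<epsilon> > 0"
    then have "eventually (\<lambda>x. m - \<epsilon> / 2 \<le> f x \<and> f x \<le> m + \<epsilon> / 2) F" using R by simp
    then show "eventually (\<lambda>x. dist (f x) m < \<epsilon>) F"
      by eventually_elim (use \<open>\<epsilon> > 0\<close> in \<open>auto simp: dist_real_def\<close>)
  qed
qed

lemma downward_of_slope:
  assumes "continuous_on UNIV d" "((\<lambda>x. d x / x) \<longlongrightarrow> m) at_bot" "m > 0"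
  shows "downward d"
proof -
  have "LIM x at_bot. (d x / x) * x :> at_bot"
    by (rule filterlim_tendsto_pos_mult_at_bot[OF assms(2,3)]) (rule filterlim_ident)
  moreover have "eventually (\<lambda>x. (d x / x) * x = d x) at_bot"
    using eventually_gt_at_bot[of "0::real"] by eventually_elim auto
  ultimately show ?thesis
    using assms(1) by (simp add: downward_def filterlim_cong)
qed

text \<open>A line through the origin with slope slightly above m eventually dominates d and, being
  increasing, also its running maximum. From below the running maximum is bounded by d
  itself.\<close>

lemma running_max_slope_at_top:
  assumes d: "downward d" and lim: "((\<lambda>x. d x / x) \<longlongrightarrow> m) at_top" and "m > 0"
  shows "((\<lambda>x. running_max d x / x) \<longlongrightarrow> m) at_top"
  unfolding tendsto_iff_bounds
proof (intro allI impI)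
  fix \<epsilon> :: real assume "\<epsilon> > 0"
  then have "eventually (\<lambda>x. m - \<epsilon> \<le> d x / x \<and> d x / x \<le> m + \<epsilon>) at_top"
    using lim by (simp add: tendsto_iff_bounds)
  then obtain N where N: "\<And>x. x \<ge> N \<Longrightarrow> m - \<epsilon> \<le> d x / x \<and> d x / x \<le> m + \<epsilon>"
    by (auto simp: eventually_at_top_linorder)
  define M where "M = max N 1"
  have bd: "(m - \<epsilon>) * x \<le> d x \<and> d x \<le> (m + \<epsilon>) * x" if "x \<ge> M" for x
    using N[of x] that by (auto simp: M_def field_simps)
  \<comment> \<open>Beyond the second bound the line also exceeds the maximum up to M, so only the
    window from M to x has to be controlled.\<close>
  have "eventually (\<lambda>x. x \<ge> max M (running_max d M / (m + \<epsilon>))) at_top"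
    by (rule eventually_ge_at_top)
  then show "eventually (\<lambda>x. m - \<epsilon> \<le> running_max d x / x \<and> running_max d x / x \<le> m + \<epsilon>) at_top"
  proof eventually_elim
    case (elim x)
    then have x: "x \<ge> M" "x > 0" "running_max d M \<le> (m + \<epsilon>) * x"
      using \<open>m > 0\<close> \<open>\<epsilon> > 0\<close> by (auto simp: field_simps M_def)
    have "running_max d x \<le> (m + \<epsilon>) * x"
    proof (rule running_max_le[OF d x(3)])
      fix z assume z: "M \<le> z" "z \<le> x"
      then have "d z \<le> (m + \<epsilon>) * z" using bd by simp
      also have "\<dots> \<le> (m + \<epsilon>) * x" using z \<open>m > 0\<close> \<open>\<epsilon> > 0\<close> by (intro mult_left_mono) auto
      finally show "d z \<le> (m + \<epsilon>) * x" .
    qed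
    moreover have "(m - \<epsilon>) * x \<le> running_max d x"
      using bd[OF x(1)] le_running_max[OF d order_refl, of x] by simp
    ultimately show ?case using \<open>x > 0\<close> by (simp add: field_simps)
  qed
qed

lemma running_max_slope_at_bot:
  assumes d: "downward d" and lim: "((\<lambda>x. d x / x) \<longlongrightarrow> m) at_bot" and "m > 0"
  shows "((\<lambda>x. running_max d x / x) \<longlongrightarrow> m) at_bot"
  unfolding tendsto_iff_bounds
proof (intro allI impI)
  fix \<epsilon>' :: real assume "\<epsilon>' > 0"
  \<comment> \<open>Capping \<epsilon> at m keeps m - \<epsilon> nonnegative. The line (m -
    \<epsilon>) z dominating d near -\<infinity> is then nondecreasing, so its value at x bounds d
    on all of the past of x.\<close>
  define \<epsilon> where "\<epsilon> = min \<epsilon>' m"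
  have \<epsilon>: "\<epsilon> > 0" "\<epsilon> \<le> m" "\<epsilon> \<le> \<epsilon>'" using \<open>\<epsilon>' > 0\<close> \<open>m > 0\<close> by (auto simp: \<epsilon>_def)
  have "eventually (\<lambda>x. m - \<epsilon> \<le> d x / x \<and> d x / x \<le> m + \<epsilon>) at_bot"
    using lim \<epsilon> by (simp add: tendsto_iff_bounds)
  then obtain N where N: "\<And>x. x \<le> N \<Longrightarrow> m - \<epsilon> \<le> d x / x \<and> d x / x \<le> m + \<epsilon>"
    by (auto simp: eventually_at_bot_linorder)
  define M where "M = min N (- 1)"
  have bd: "(m + \<epsilon>) * x \<le> d x \<and> d x \<le> (m - \<epsilon>) * x" if "x \<le> M" for x
    using N[of x] that by (auto simp: M_def field_simps)
  have "eventually (\<lambda>x. x \<le> M) at_bot"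
    by (rule eventually_le_at_bot)
  then show "eventually (\<lambda>x. m - \<epsilon>' \<le> running_max d x / x \<and> running_max d x / x \<le> m + \<epsilon>') at_bot"
  proof eventually_elim
    case (elim x)
    then have "x < 0" by (auto simp: M_def)
    have "running_max d x \<le> (m - \<epsilon>) * x"
      unfolding running_max_le_iff[OF d]
    proof (intro allI impI)
      fix z assume z: "z \<le> x"
      then have "d z \<le> (m - \<epsilon>) * z" using bd elim by simp
      also have "\<dots> \<le> (m - \<epsilon>) * x" using z \<epsilon> by (intro mult_left_mono) auto
      finally show "d z \<le> (m - \<epsilon>) * x" .
    qed
    moreover have "(m + \<epsilon>) * x \<le> running_max d x"
      using bd[OF elim] le_running_max[OF d order_refl, of x] by simp
    ultimately have "m - \<epsilon> \<le> running_max d x / x \<and> running_max d x / x \<le> m + \<epsilon>"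
      using \<open>x < 0\<close> by (simp add: field_simps)
    then show ?case using \<epsilon> by auto
  qed
qed

text \<open>By the intermediate value theorem d takes the value of its maximum up to w somewhere in
  [w, y]. At the earliest such time it has not yet exceeded that value, so the running maximum is
  still the old one.\<close>

lemma first_hit:
  assumes d: "downward d" and "w \<le> y" and "running_max d w \<le> d y"
  shows "\<exists>z. w \<le> z \<and> z \<le> y \<and> d z = running_max d w \<and> running_max d z = running_max d w"
proof -
  let ?s = "running_max d w"
  have cont: "continuous_on S d" for S
    using d continuous_on_subset by (auto simp: downward_def)
  have hit: "\<exists>z. w \<le> z \<and> z \<le> u \<and> d z = ?s" if "w \<le> u" "?s \<le> d u" for u
    using IVT'[of d w ?s u] that cont le_running_max[OF d order_refl, of w] by auto
  define A where "A = {z\<in>{w..y}. d z = ?s}"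
  have "closed {z. d z = ?s}"
    using cont by (intro closed_Collect_eq) auto
  then have "compact A"
    using compact_Int_closed[OF compact_Icc, of "{z. d z = ?s}" w y] by (simp add: A_def Int_def)
  moreover have "A \<noteq> {}" using hit[of y] assms by (auto simp: A_def)
  ultimately obtain z where z: "z \<in> A" "\<And>u. u \<in> A \<Longrightarrow> z \<le> u"
    using compact_attains_inf[of A] by auto
  have "running_max d z \<le> ?s"
  proof (rule running_max_le[OF d order_refl])
    fix u assume u: "w \<le> u" "u \<le> z"
    show "d u \<le> ?s"
    proof (rule ccontr)
      assume gt: "\<not> ?thesis"
      then obtain v where "w \<le> v" "v \<le> u" "d v = ?s" using hit[of u] u by auto
      moreover from this u z(1) have "v \<in> A" by (auto simp: A_def)
      ultimately have "u = z" using z(2) u by force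
      then show False using gt z(1) by (auto simp: A_def)
    qed
  qed
  moreover have "?s \<le> running_max d z"
    using z(1) by (intro running_max_mono[OF d]) (auto simp: A_def)
  ultimately show ?thesis
    using z(1) by (intro exI[of _ z]) (auto simp: A_def)
qed

text \<open>The reflection principle behind both the braid relation (on bounded windows) and the
  reversibility of the Pitman operators (on half lines).\<close>

lemma reflected_max_window:
  assumes d: "downward d" and "w \<le> x"
  shows "(\<forall>z\<in>{w..x}. d z - 2 * running_max d z + running_max d x + running_max d w \<le> c)
    \<longleftrightarrow> (\<forall>z\<in>{w..x}. d z \<le> c)" (is "?L \<longleftrightarrow> ?R")
proof
  assume L: ?L
  show ?R
  proof
    fix z assume z: "z \<in> {w..x}"
    show "d z \<le> c"
    proof (cases "\<exists>y\<in>{w..x}. running_max d w \<le> d y")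
      case True
      then obtain y where "y \<in> {w..x}" "running_max d w \<le> d y" by blast
      \<comment> \<open>At the first hit u the reflected expression equals
        \<open>running_max d x\<close>.\<close>
      with first_hit[OF d, of w y] obtain u where
        "u \<in> {w..x}" "d u = running_max d w" "running_max d u = running_max d w" by force
      with L have "running_max d x \<le> c" by force
      then show ?thesis using le_running_max[OF d, of z x] z by auto
    next
      case False
      \<comment> \<open>The running maximum is constant on the window, so there the reflected
        expression is d z itself.\<close>
      then have "running_max d x \<le> running_max d w"
        by (intro running_max_le[OF d order_refl]) force
      with running_max_mono[OF d, of w z] running_max_mono[OF d, of z x] z L show ?thesis by force
    qed
  qed
next
  assume R: ?R
  show ?L
  proof
    fix z assume z: "z \<in> {w..x}"
    have m: "running_max d w \<le> running_max d z" "running_max d z \<le> running_max d x"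
      "d z \<le> running_max d z"
      using z by (auto intro: running_max_mono[OF d] le_running_max[OF d])
    show "d z - 2 * running_max d z + running_max d x + running_max d w \<le> c"
    \<comment> \<open>If c is at most the old maximum, the running maximum is again constant on the
      window. Otherwise \<open>running_max d x\<close> is at most c, and what is added to it in the
      reflected expression is nonpositive.\<close>
    proof (cases "c \<le> running_max d w")
      case True
      then have "running_max d x \<le> running_max d w"
        using R by (intro running_max_le[OF d order_refl]) force
      with m R z show ?thesis by force
    next
      case False
      have "running_max d x \<le> c"
      proof (rule running_max_le[OF d])
        show "running_max d w \<le> c" using False by simp
      qed (use R in simp)
      with m show ?thesis by linarith
    qed
  qed
qed

text \<open>The value is attained where d first returns to its maximum over the past of x, which
  happens because d tends to \<infinity>. It is an upper bound because d z is at most its running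
  maximum, which is nondecreasing.\<close>

lemma reflected_max_half_line:
  assumes d: "downward d" and lim: "filterlim d at_top at_top"
  shows "(SUP z\<in>{x..}. d z - 2 * running_max d z) = - running_max d x"
proof (rule cSup_eq_maximum)
  obtain y where "x \<le> y" "running_max d x \<le> d y"
    using lim unfolding filterlim_at_top
    by (metis eventually_at_top_linorder linorder_linear)
  from first_hit[OF d this] show "- running_max d x \<in> (\<lambda>z. d z - 2 * running_max d z) ` {x..}"
    by force
next
  fix u assume "u \<in> (\<lambda>z. d z - 2 * running_max d z) ` {x..}"
  then obtain z where z: "x \<le> z" "u = d z - 2 * running_max d z" by auto
  then show "u \<le> - running_max d x"
    using le_running_max[OF d order_refl, of z] running_max_mono[OF d z(1)] by linarith
qed

section \<open>The Pitman transform of two real paths\<close>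

text \<open>With the running maximum expanded, \<open>pitman_up a b x\<close> is the supremum over z
  \<le> x of b z + (a x - a z), a last passage value, and \<open>pitman_down a b x\<close> is the
  infimum of a z + (b x - b z), a first passage value.\<close>

definition pitman_up :: "(real \<Rightarrow> real) \<Rightarrow> (real \<Rightarrow> real) \<Rightarrow> real \<Rightarrow> real" where
  "pitman_up a b x = a x + running_max (\<lambda>z. b z - a z) x"

definition pitman_down :: "(real \<Rightarrow> real) \<Rightarrow> (real \<Rightarrow> real) \<Rightarrow> real \<Rightarrow> real" where
  "pitman_down a b x = b x - running_max (\<lambda>z. b z - a z) x"

abbreviation ascends :: "(real \<Rightarrow> real) \<Rightarrow> (real \<Rightarrow> real) \<Rightarrow> bool" where
  "ascends a b \<equiv> downward (\<lambda>z. b z - a z)"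

section \<open>Passage values and the braid relation for three real paths\<close>

lemma pitman_up_le_iff:
  assumes "ascends a b"
  shows "pitman_up a b x \<le> c \<longleftrightarrow> (\<forall>z\<le>x. b z - a z + a x \<le> c)"
proof -
  have "pitman_up a b x \<le> c \<longleftrightarrow> running_max (\<lambda>z. b z - a z) x \<le> c - a x"
    unfolding pitman_up_def by linarith
  also have "\<dots> \<longleftrightarrow> (\<forall>z\<le>x. b z - a z + a x \<le> c)"
    unfolding running_max_le_iff[OF assms] by (simp add: le_diff_eq)
  finally show ?thesis .
qed

lemma pitman_down_ge_iff:
  assumes "ascends a b"
  shows "c \<le> pitman_down a b x \<longleftrightarrow> (\<forall>z\<le>x. c \<le> a z - b z + b x)"
proof -
  have "c \<le> pitman_down a b x \<longleftrightarrow> running_max (\<lambda>z. b z - a z) x \<le> b x - c"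
    unfolding pitman_down_def by linarith
  also have "\<dots> \<longleftrightarrow> (\<forall>z\<le>x. c \<le> a z - b z + b x)"
  proof -
    have "b z - a z \<le> b x - c \<longleftrightarrow> c \<le> a z - b z + b x" for z by linarith
    then show ?thesis unfolding running_max_le_iff[OF assms] by simp
  qed
  finally show ?thesis .
qed

lemma pitman_up_add_down: "pitman_up a b x + pitman_down a b x = a x + b x"
  by (simp add: pitman_up_def pitman_down_def)

lemma eq_if_le_iff: "(\<And>c. x \<le> c \<longleftrightarrow> y \<le> c) \<Longrightarrow> x = (y::'a::order)"
  by (simp add: order_eq_iff)

lemma eq_if_ge_iff: "(\<And>c. c \<le> x \<longleftrightarrow> c \<le> y) \<Longrightarrow> x = (y::'a::order)"
  by (metis order_antisym order_refl)

lemma all_triangle_swap: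
  fixes x :: "'a::preorder"
  shows "(\<forall>z\<le>x. \<forall>w\<le>z. P w z) \<longleftrightarrow> (\<forall>w\<le>x. \<forall>z\<in>{w..x}. P w z)"
  by (auto intro: order_trans)

text \<open>Both sides are last passage values across \<open>c\<close>, \<open>b\<close>, \<open>a\<close>; replacing \<open>(a, b)\<close> by its Pitman
  transform does not change the last passage values across two lines.\<close>

lemma pitman_up_braid:
  assumes ab: "ascends a b" and bc: "ascends b c" and a_up: "ascends a (pitman_up b c)"
    and dc: "ascends (pitman_down a b) c"
    and uu: "ascends (pitman_up a b) (pitman_up (pitman_down a b) c)"
  shows "pitman_up (pitman_up a b) (pitman_up (pitman_down a b) c) = pitman_up a (pitman_up b c)"
proof (rule ext, rule eq_if_le_iff)
  fix x t
  let ?a = "pitman_up a b" and ?b = "pitman_down a b" and ?d = "\<lambda>z. b z - a z"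
  let ?S = "running_max ?d"
  have rearrange: "p - q + r \<le> t \<longleftrightarrow> p \<le> t + q - r" for p q r :: real by linarith
  have window: "c w - ?b w + ?b z \<le> t + ?a z - ?a x
      \<longleftrightarrow> ?d z - 2 * ?S z + ?S x + ?S w \<le> t - a x + b w - c w"
    and plain: "?d z \<le> t - a x + b w - c w \<longleftrightarrow> c w - b w + b z \<le> t + a z - a x" for w z
    unfolding pitman_up_def pitman_down_def by linarith+
  have "pitman_up ?a (pitman_up ?b c) x \<le> t \<longleftrightarrow> (\<forall>z\<le>x. pitman_up ?b c z \<le> t + ?a z - ?a x)"
    by (simp only: pitman_up_le_iff[OF uu] rearrange)
  \<comment> \<open>Exchanging the quantifiers fixes the outer jump time w. Only the inner jump time
    z varies, over the window from w to x, which is the situation of the reflection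
    principle.\<close>
  also have "\<dots> \<longleftrightarrow> (\<forall>w\<le>x. \<forall>z\<in>{w..x}. c w - ?b w + ?b z \<le> t + ?a z - ?a x)"
    by (simp only: pitman_up_le_iff[OF dc] all_triangle_swap)
  also have "\<dots> \<longleftrightarrow> (\<forall>w\<le>x. \<forall>z\<in>{w..x}. ?d z - 2 * ?S z + ?S x + ?S w \<le> t - a x + b w - c w)"
    by (simp only: window)
  also have "\<dots> \<longleftrightarrow> (\<forall>w\<le>x. \<forall>z\<in>{w..x}. ?d z \<le> t - a x + b w - c w)"
    by (intro all_cong1 imp_cong refl reflected_max_window[OF ab])
  also have "\<dots> \<longleftrightarrow> (\<forall>z\<le>x. \<forall>w\<le>z. c w - b w + b z \<le> t + a z - a x)"
    by (simp only: plain all_triangle_swap)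
  also have "\<dots> \<longleftrightarrow> pitman_up a (pitman_up b c) x \<le> t"
    by (simp only: pitman_up_le_iff[OF a_up] pitman_up_le_iff[OF bc] rearrange)
  finally show "pitman_up ?a (pitman_up ?b c) x \<le> t \<longleftrightarrow> pitman_up a (pitman_up b c) x \<le> t" .
qed

text \<open>The mirror image of \<open>pitman_up_braid\<close>: both sides are first passage values
  across a, b, c, and now the pair (b, c) may be replaced by its Pitman transform.\<close>

lemma pitman_down_braid:
  assumes ab: "ascends a b" and bc: "ascends b c" and d_c: "ascends (pitman_down a b) c"
    and au: "ascends a (pitman_up b c)"
    and dd: "ascends (pitman_down a (pitman_up b c)) (pitman_down b c)"
  shows "pitman_down (pitman_down a (pitman_up b c)) (pitman_down b c) = pitman_down (pitman_down a b) c"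
proof (rule ext, rule eq_if_ge_iff)
  fix x t
  let ?b = "pitman_up b c" and ?c = "pitman_down b c" and ?d = "\<lambda>z. c z - b z"
  let ?S = "running_max ?d"
  have rearrange: "t \<le> p - q + r \<longleftrightarrow> t + q - r \<le> p" for p q r :: real by linarith
  have window: "t + ?c z - ?c x \<le> a w - ?b w + ?b z
      \<longleftrightarrow> ?d z - 2 * ?S z + ?S x + ?S w \<le> a w - b w + c x - t"
    and plain: "?d z \<le> a w - b w + c x - t \<longleftrightarrow> t + c z - c x \<le> a w - b w + b z" for w z
    unfolding pitman_up_def pitman_down_def by linarith+
  have "t \<le> pitman_down (pitman_down a ?b) ?c x \<longleftrightarrow> (\<forall>z\<le>x. t + ?c z - ?c x \<le> pitman_down a ?b z)"
    by (simp only: pitman_down_ge_iff[OF dd] rearrange)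
  also have "\<dots> \<longleftrightarrow> (\<forall>w\<le>x. \<forall>z\<in>{w..x}. t + ?c z - ?c x \<le> a w - ?b w + ?b z)"
    by (simp only: pitman_down_ge_iff[OF au] all_triangle_swap)
  also have "\<dots> \<longleftrightarrow> (\<forall>w\<le>x. \<forall>z\<in>{w..x}. ?d z - 2 * ?S z + ?S x + ?S w \<le> a w - b w + c x - t)"
    by (simp only: window)
  also have "\<dots> \<longleftrightarrow> (\<forall>w\<le>x. \<forall>z\<in>{w..x}. ?d z \<le> a w - b w + c x - t)"
    by (intro all_cong1 imp_cong refl reflected_max_window[OF bc])
  also have "\<dots> \<longleftrightarrow> (\<forall>z\<le>x. \<forall>w\<le>z. t + c z - c x \<le> a w - b w + b z)"
    by (simp only: plain all_triangle_swap)
  also have "\<dots> \<longleftrightarrow> t \<le> pitman_down (pitman_down a b) c x"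
    by (simp only: pitman_down_ge_iff[OF d_c] pitman_down_ge_iff[OF ab] rearrange)
  finally show "t \<le> pitman_down (pitman_down a ?b) ?c x \<longleftrightarrow> t \<le> pitman_down (pitman_down a b) c x" .
qed

section \<open>Pitman operators on paths\<close>

lemma slope_eqI: "is_slope n f l \<Longrightarrow> slope n f = l"
  unfolding slope_def by (intro the_equality is_slope_unique)

lemma slope_tendsto:
  assumes "f \<in> paths n" "j \<in> {1..n}"
  shows "((\<lambda>x. f x j / x) \<longlongrightarrow> slope n f j) at_top" "((\<lambda>x. f x j / x) \<longlongrightarrow> slope n f j) at_bot"
  using is_slope_slope[OF assms(1)] assms(2) by (auto simp: is_slope_def)

lemma slope_in_Rvec: "f \<in> paths n \<Longrightarrow> slope n f \<in> Rvec n"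
  using is_slope_slope by (auto simp: is_slope_def)

lemma continuous_coord: "f \<in> paths n \<Longrightarrow> j \<in> {1..n} \<Longrightarrow> continuous_on UNIV (\<lambda>x. f x j)"
  by (simp add: paths_def)

lemma slope_pair_at:
  assumes "f \<in> paths n" "i \<in> {1..<n}"
  shows "slope 2 (pair_at i f) = (\<lambda>_. undefined)(1 := slope n f i, 2 := slope n f (i + 1))"
proof (rule slope_eqI)
  have "i \<in> {1..n}" "i + 1 \<in> {1..n}" using assms by auto
  note this[THEN slope_tendsto(1)[OF assms(1)]] this[THEN slope_tendsto(2)[OF assms(1)]]
  moreover have "{1..2::nat} = {1, 2}" by auto
  ultimately show "is_slope 2 (pair_at i f) ((\<lambda>_. undefined)(1 := slope n f i, 2 := slope n f (i + 1)))"
    by (auto simp: is_slope_def pair_at_def Rvec_def PiE_def extensional_def)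
qed

lemma pitman_at_not_ascending:
  assumes "f \<in> paths n" "i \<in> {1..<n}" "\<not> slope n f i < slope n f (i + 1)"
  shows "pitman_at i f = f"
proof -
  have "pitman (pair_at i f) = pair_at i f"
    using assms(3) by (simp add: pitman_def slope_pair_at[OF assms(1,2)])
  then show ?thesis by (simp add: pitman_at_def pair_at_def fun_eq_iff)
qed

lemma pitman_at_ascending:
  assumes "f \<in> paths n" "i \<in> {1..<n}" "slope n f i < slope n f (i + 1)"
  shows "pitman_at i f = (\<lambda>x. (f x)
    (i := pitman_up (\<lambda>x. f x i) (\<lambda>x. f x (i + 1)) x,
     i + 1 := pitman_down (\<lambda>x. f x i) (\<lambda>x. f x (i + 1)) x))"
proof -
  have "pitman (pair_at i f) = (\<lambda>x. (pair_at i f x)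
      (1 := pair_at i f x 1 + running_max (\<lambda>z. pair_at i f z 2 - pair_at i f z 1) x,
       2 := pair_at i f x 2 - running_max (\<lambda>z. pair_at i f z 2 - pair_at i f z 1) x))"
    using assms(3) by (simp add: pitman_def running_max_def slope_pair_at[OF assms(1,2)])
  then show ?thesis
    by (simp add: pitman_at_def pitman_up_def pitman_down_def) (simp add: pair_at_def)
qed

lemma diff_slope:
  assumes "f \<in> paths n" "i \<in> {1..n}" "j \<in> {1..n}"
  shows "((\<lambda>x. (f x j - f x i) / x) \<longlongrightarrow> slope n f j - slope n f i) at_top"
    "((\<lambda>x. (f x j - f x i) / x) \<longlongrightarrow> slope n f j - slope n f i) at_bot"
  unfolding diff_divide_distrib using assms by (auto intro!: tendsto_diff slope_tendsto)

text \<open>The difference of the two coordinates has positive slope, hence tends to -\<infinity> at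
  -\<infinity>.\<close>

lemma ascends_coords:
  assumes "f \<in> paths n" "i \<in> {1..n}" "j \<in> {1..n}" "slope n f i < slope n f j"
  shows "ascends (\<lambda>x. f x i) (\<lambda>x. f x j)"
proof (rule downward_of_slope)
  show "continuous_on UNIV (\<lambda>z. f z j - f z i)"
    using assms by (intro continuous_intros continuous_coord)
  show "((\<lambda>x. (f x j - f x i) / x) \<longlongrightarrow> slope n f j - slope n f i) at_bot"
    using assms by (intro diff_slope)
qed (use assms in simp)

text \<open>The running maximum of the difference of the two coordinates inherits the slope of that
  difference at both ends. Adding it to coordinate i and subtracting it from coordinate i + 1
  therefore exchanges their slopes.\<close>

lemma pitman_at_ascending_paths:
  assumes f: "f \<in> paths n" and i: "i \<in> {1..<n}" and asc: "slope n f i < slope n f (i + 1)"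
  shows "pitman_at i f \<in> paths n"
    and "slope n (pitman_at i f) = (slope n f)(i := slope n f (i + 1), i + 1 := slope n f i)"
proof -
  let ?a = "\<lambda>x. f x i" and ?b = "\<lambda>x. f x (i + 1)"
  let ?d = "\<lambda>x. ?b x - ?a x" and ?m = "slope n f (i + 1) - slope n f i"
  let ?l = "(slope n f)(i := slope n f (i + 1), i + 1 := slope n f i)"
  have ij: "i \<in> {1..n}" "i + 1 \<in> {1..n}" using i by auto
  have d: "downward ?d" by (rule ascends_coords[OF f ij asc])
  have "?m > 0" using asc by simp
  note lim = running_max_slope_at_top[OF d diff_slope(1)[OF f ij] this]
    running_max_slope_at_bot[OF d diff_slope(2)[OF f ij] this]
  have up: "((\<lambda>x. pitman_up ?a ?b x / x) \<longlongrightarrow> slope n f (i + 1)) F"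
    and down: "((\<lambda>x. pitman_down ?a ?b x / x) \<longlongrightarrow> slope n f i) F"
    if "F = at_top \<or> F = at_bot" for F
    using that tendsto_add[OF slope_tendsto(1)[OF f ij(1)] lim(1)]
      tendsto_add[OF slope_tendsto(2)[OF f ij(1)] lim(2)]
      tendsto_diff[OF slope_tendsto(1)[OF f ij(2)] lim(1)]
      tendsto_diff[OF slope_tendsto(2)[OF f ij(2)] lim(2)]
    by (auto simp: pitman_up_def pitman_down_def add_divide_distrib diff_divide_distrib)
  have cont: "continuous_on UNIV (pitman_up ?a ?b)" "continuous_on UNIV (pitman_down ?a ?b)"
    unfolding pitman_up_def pitman_down_def
    by (intro continuous_intros continuous_running_max[OF d] continuous_coord[OF f] ij)+
  have in_R: "f x \<in> Rvec n" for x using f by (simp add: paths_def)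
  have slope: "is_slope n (pitman_at i f) ?l"
    unfolding is_slope_def
  proof (intro conjI ballI)
    show "?l \<in> Rvec n"
      using slope_in_Rvec[OF f] i by (auto simp: Rvec_def PiE_def extensional_def)
    show "((\<lambda>x. pitman_at i f x j / x) \<longlongrightarrow> ?l j) at_top"
      "((\<lambda>x. pitman_at i f x j / x) \<longlongrightarrow> ?l j) at_bot" if "j \<in> {1..n}" for j
      using up down slope_tendsto[OF f that]
      by (auto simp: pitman_at_ascending[OF f i asc])
  qed
  then show "slope n (pitman_at i f) = ?l" by (rule slope_eqI)
  have "continuous_on UNIV (\<lambda>x. pitman_at i f x j)" if "j \<in> {1..n}" for j
    using cont continuous_coord[OF f that]
    by (cases "j = i"; cases "j = i + 1") (simp_all add: pitman_at_ascending[OF f i asc])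
  moreover have "pitman_at i f x \<in> Rvec n" for x
    using in_R[of x] i by (auto simp: pitman_at_ascending[OF f i asc] Rvec_def PiE_def extensional_def)
  ultimately show "pitman_at i f \<in> paths n"
    using slope by (auto simp: paths_def)
qed

lemma pitman_at_paths:
  assumes "f \<in> paths n" "i \<in> {1..<n}"
  shows "pitman_at i f \<in> paths n"
  by (cases "slope n f i < slope n f (i + 1)")
    (use assms pitman_at_ascending_paths(1) pitman_at_not_ascending in auto)

lemma slope_pitman_at:
  assumes "f \<in> paths n" "i \<in> {1..<n}"
  shows "slope n (pitman_at i f) = basic_gen n (Tau i) (slope n f)"
  using pitman_at_ascending_paths(2)[OF assms] pitman_at_not_ascending[OF assms]
    slope_in_Rvec[OF assms(1)]
  by (cases "slope n f i < slope n f (i + 1)") auto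

section \<open>Time reversal and the inverse operators\<close>

lemma reflect_reflect [simp]: "reflect (reflect f) = f"
  by (simp add: reflect_def)

lemma is_slope_reflect:
  assumes "is_slope n f l"
  shows "is_slope n (reflect f) (\<lambda>j\<in>{1..n}. - l j)"
proof -
  have "((\<lambda>x. f (- x) j / x) \<longlongrightarrow> - l j) at_top" "((\<lambda>x. f (- x) j / x) \<longlongrightarrow> - l j) at_bot"
    if "j \<in> {1..n}" for j
  proof -
    have lim: "((\<lambda>x. - (f x j / x)) \<longlongrightarrow> - l j) at_top" "((\<lambda>x. - (f x j / x)) \<longlongrightarrow> - l j) at_bot"
      using assms that by (auto simp: is_slope_def intro!: tendsto_minus)
    show "((\<lambda>x. f (- x) j / x) \<longlongrightarrow> - l j) at_top"
      using lim(2) by (subst (asm) filterlim_at_bot_mirror) simp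
    show "((\<lambda>x. f (- x) j / x) \<longlongrightarrow> - l j) at_bot"
      using lim(1) by (subst filterlim_at_bot_mirror) simp
  qed
  then show ?thesis by (auto simp: is_slope_def reflect_def Rvec_def)
qed

lemma reflect_paths:
  assumes "f \<in> paths n"
  shows "reflect f \<in> paths n"
proof -
  have "continuous_on UNIV (\<lambda>x. f (- x) j)" if "j \<in> {1..n}" for j
    by (rule continuous_on_compose2[OF continuous_coord[OF assms that]])
      (auto intro: continuous_on_minus continuous_on_id)
  then show ?thesis
    using assms is_slope_reflect by (fastforce simp: paths_def reflect_def)
qed

lemma slope_reflect: "f \<in> paths n \<Longrightarrow> slope n (reflect f) = (\<lambda>j\<in>{1..n}. - slope n f j)"
  using is_slope_reflect is_slope_slope slope_eqI by blast

text \<open>The operator of \<open>TauBar i\<close> freed from the restriction to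
  \<open>paths n\<close>, as \<open>pitman_at i\<close> is for \<open>Tau i\<close>.\<close>

definition pitman_bar_at :: "nat \<Rightarrow> (real \<Rightarrow> nat \<Rightarrow> real) \<Rightarrow> real \<Rightarrow> nat \<Rightarrow> real" where
  "pitman_bar_at i f = reflect (pitman_at i (reflect f))"

lemma pitman_bar_at_paths:
  "f \<in> paths n \<Longrightarrow> i \<in> {1..<n} \<Longrightarrow> pitman_bar_at i f \<in> paths n"
  by (simp add: pitman_bar_at_def reflect_paths pitman_at_paths)

text \<open>Reflection negates slopes, so descents of f are ascents of
  \<open>reflect f\<close>.\<close>

lemma pitman_bar_at_not_descending:
  assumes "f \<in> paths n" "i \<in> {1..<n}" "\<not> slope n f i > slope n f (i + 1)"
  shows "pitman_bar_at i f = f"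
  using assms pitman_at_not_ascending[OF reflect_paths[OF assms(1)] assms(2)]
  by (simp add: pitman_bar_at_def slope_reflect)

lemma slope_pitman_bar_at:
  assumes f: "f \<in> paths n" and i: "i \<in> {1..<n}"
  shows "slope n (pitman_bar_at i f) = basic_gen n (TauBar i) (slope n f)"
proof -
  have "slope n (pitman_bar_at i f) =
      (\<lambda>j\<in>{1..n}. - basic_gen n (Tau i) (\<lambda>j\<in>{1..n}. - slope n f j) j)"
    using assms by (simp add: pitman_bar_at_def slope_reflect slope_pitman_at reflect_paths pitman_at_paths)
  then show ?thesis
    using i slope_in_Rvec[OF f] slope_in_Rvec[OF reflect_paths[OF f]]
    by (auto simp: slope_reflect[OF f] Rvec_def PiE_def extensional_def fun_eq_iff)
qed

text \<open>After the transform the difference d of the two coordinates has become d minus twice its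
  running maximum. Its supremum over the future of x, which is what the reversed operator adds to
  coordinate i, is by reflection minus the running maximum of d at x, so the change is
  undone.\<close>

lemma pitman_bar_at_pitman_at:
  assumes f: "f \<in> paths n" and i: "i \<in> {1..<n}" and asc: "slope n f i < slope n f (i + 1)"
  shows "pitman_bar_at i (pitman_at i f) = f"
proof (intro ext)
  fix x j
  let ?d = "\<lambda>x. f x (i + 1) - f x i"
  let ?g = "pitman_at i f"
  have ij: "i \<in> {1..n}" "i + 1 \<in> {1..n}" using i by auto
  have d: "downward ?d" by (rule ascends_coords[OF f ij asc])
  have g: "?g \<in> paths n" using f i by (rule pitman_at_paths)
  \<comment> \<open>Swapping the two slopes and negating them both restores the ascent.\<close>
  have asc': "slope n (reflect ?g) i < slope n (reflect ?g) (i + 1)"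
    using asc i by (auto simp: slope_reflect[OF g] pitman_at_ascending_paths(2)[OF f i asc])
  have "LIM x at_top. (?d x / x) * x :> at_top"
    using asc by (intro filterlim_tendsto_pos_mult_at_top[OF diff_slope(1)[OF f ij]] filterlim_ident) simp
  moreover have "eventually (\<lambda>x. (?d x / x) * x = ?d x) at_top"
    using eventually_gt_at_top[of "0::real"] by eventually_elim auto
  ultimately have top: "filterlim ?d at_top at_top"
    by (simp add: filterlim_cong)
  let ?M = "running_max (\<lambda>z. ?g (- z) (i + 1) - ?g (- z) i) (- x)"
  have "?M = (SUP z\<in>{x..}. ?g z (i + 1) - ?g z i)"
  proof -
    \<comment> \<open>Under time reversal the past of -x becomes the future of x.\<close>
    have "{x..} = uminus ` {..- x}" by simp
    then show ?thesis unfolding running_max_def by (simp only: image_image)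
  qed
  also have "\<dots> = (SUP z\<in>{x..}. ?d z - 2 * running_max ?d z)"
    by (simp add: pitman_at_ascending[OF f i asc] pitman_up_def pitman_down_def algebra_simps)
  also have "\<dots> = - running_max ?d x"
    by (rule reflected_max_half_line[OF d top])
  finally have M: "?M = - running_max ?d x" .
  have "pitman_bar_at i ?g x = (?g x)(i := ?g x i + ?M, i + 1 := ?g x (i + 1) - ?M)"
    unfolding pitman_bar_at_def reflect_def[of "pitman_at i (reflect ?g)"]
      pitman_at_ascending[OF reflect_paths[OF g] i asc']
    by (simp add: reflect_def pitman_up_def pitman_down_def fun_eq_iff)
  also have "\<dots> = (?g x)(i := ?g x i - running_max ?d x, i + 1 := ?g x (i + 1) + running_max ?d x)"
    unfolding M by simp
  also have "\<dots> = f x"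
    unfolding pitman_at_ascending[OF f i asc]
    by (simp add: pitman_up_def pitman_down_def fun_eq_iff)
  finally show "pitman_bar_at i ?g x j = f x j" by simp
qed

text \<open>The preceding lemma for \<open>reflect f\<close>, conjugated by time reversal.\<close>

lemma pitman_at_pitman_bar_at:
  assumes f: "f \<in> paths n" and i: "i \<in> {1..<n}" and desc: "slope n f i > slope n f (i + 1)"
  shows "pitman_at i (pitman_bar_at i f) = f"
proof -
  have "pitman_bar_at i (pitman_at i (reflect f)) = reflect f"
    using i desc by (intro pitman_bar_at_pitman_at[OF reflect_paths[OF f]]) (auto simp: slope_reflect[OF f])
  then show ?thesis
    by (metis pitman_bar_at_def reflect_reflect)
qed

section \<open>Commutation and braid relations at ascents\<close>

lemma pitman_at_commute:
  assumes f: "f \<in> paths n" and i: "i \<in> {1..<n}" and j: "j \<in> {1..<n}" and "i + 1 < j"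
    and "slope n f i < slope n f (i + 1)" "slope n f j < slope n f (j + 1)"
  shows "pitman_at i (pitman_at j f) = pitman_at j (pitman_at i f)"
proof -
  have "slope n (pitman_at j f) i < slope n (pitman_at j f) (i + 1)"
    "slope n (pitman_at i f) j < slope n (pitman_at i f) (j + 1)"
    using assms by (auto simp: pitman_at_ascending_paths(2))
  note outer = pitman_at_ascending[OF pitman_at_paths[OF f j] i this(1)]
    pitman_at_ascending[OF pitman_at_paths[OF f i] j this(2)]
  show ?thesis
    unfolding outer
    unfolding pitman_at_ascending[OF f i assms(5)] pitman_at_ascending[OF f j assms(6)]
    using \<open>i + 1 < j\<close> by (simp add: fun_eq_iff)
qed

text \<open>Either word reverses three increasing slopes, and each of its letters acts at an ascent.
  All coordinates are thus explicit nested Pitman transforms, whose outer two agree by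
  \<open>pitman_up_braid\<close> and \<open>pitman_down_braid\<close>.\<close>

lemma pitman_at_braid:
  assumes f: "f \<in> paths n" and i: "i \<in> {1..<n}" and i': "i + 1 \<in> {1..<n}"
    and asc: "slope n f i < slope n f (i + 1)" "slope n f (i + 1) < slope n f (i + 2)"
  shows "pitman_at i (pitman_at (i + 1) (pitman_at i f))
    = pitman_at (i + 1) (pitman_at i (pitman_at (i + 1) f))"
proof -
  let ?a = "\<lambda>x. f x i" and ?b = "\<lambda>x. f x (i + 1)" and ?c = "\<lambda>x. f x (i + 2)"
  define f1 where "f1 = pitman_at i f"
  define f21 where "f21 = pitman_at (i + 1) f1"
  define f2 where "f2 = pitman_at (i + 1) f"
  define f12 where "f12 = pitman_at i f2"
  have sl: "slope n f i < slope n f (i + 2)" using asc by simp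
  have p1: "f1 \<in> paths n" "f2 \<in> paths n"
    using f i i' by (auto simp: f1_def f2_def pitman_at_paths)
  then have p2: "f21 \<in> paths n" "f12 \<in> paths n"
    using i i' by (auto simp: f21_def f12_def pitman_at_paths)
  have s1: "slope n f1 = (slope n f)(i := slope n f (i + 1), i + 1 := slope n f i)"
    unfolding f1_def by (rule pitman_at_ascending_paths(2)[OF f i asc(1)])
  have s2: "slope n f2 = (slope n f)(i + 1 := slope n f (i + 2), i + 2 := slope n f (i + 1))"
    unfolding f2_def using pitman_at_ascending_paths(2)[OF f i'] asc(2) by (simp add: numeral_2_eq_2)
  have a1: "slope n f1 (i + 1) < slope n f1 (i + 2)" using sl s1 by simp
  have a2: "slope n f2 i < slope n f2 (i + 1)" using sl s2 by simp
  have s21: "slope n f21 = (slope n f1)(i + 1 := slope n f1 (i + 2), i + 2 := slope n f1 (i + 1))"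
    unfolding f21_def using pitman_at_ascending_paths(2)[OF p1(1) i'] a1 by (simp add: numeral_2_eq_2)
  have s12: "slope n f12 = (slope n f2)(i := slope n f2 (i + 1), i + 1 := slope n f2 i)"
    unfolding f12_def by (rule pitman_at_ascending_paths(2)[OF p1(2) i a2])
  have a21: "slope n f21 i < slope n f21 (i + 1)" using asc s1 s21 by simp
  have a12: "slope n f12 (i + 1) < slope n f12 (i + 2)" using asc s2 s12 by simp
  have idx: "i \<in> {1..n}" "i + 1 \<in> {1..n}" "i + 2 \<in> {1..n}" using i i' by auto
  have e1: "f1 = (\<lambda>x. (f x)(i := pitman_up ?a ?b x, i + 1 := pitman_down ?a ?b x))"
    unfolding f1_def by (rule pitman_at_ascending[OF f i asc(1)])
  have e2: "f2 = (\<lambda>x. (f x)(i + 1 := pitman_up ?b ?c x, i + 2 := pitman_down ?b ?c x))"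
    unfolding f2_def using pitman_at_ascending[OF f i'] asc(2) by (simp add: numeral_2_eq_2)
  have e21: "f21 = (\<lambda>x. (f x)(i := pitman_up ?a ?b x, i + 1 := pitman_up (pitman_down ?a ?b) ?c x,
      i + 2 := pitman_down (pitman_down ?a ?b) ?c x))"
    unfolding f21_def using pitman_at_ascending[OF p1(1) i'] a1
    by (auto simp: numeral_2_eq_2 e1 fun_eq_iff)
  have e12: "f12 = (\<lambda>x. (f x)(i := pitman_up ?a (pitman_up ?b ?c) x,
      i + 1 := pitman_down ?a (pitman_up ?b ?c) x, i + 2 := pitman_down ?b ?c x))"
    unfolding f12_def using pitman_at_ascending[OF p1(2) i a2]
    by (auto simp: numeral_2_eq_2 e2 fun_eq_iff)
  have e121: "pitman_at i f21 = (\<lambda>x. (f x)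
      (i := pitman_up (pitman_up ?a ?b) (pitman_up (pitman_down ?a ?b) ?c) x,
       i + 1 := pitman_down (pitman_up ?a ?b) (pitman_up (pitman_down ?a ?b) ?c) x,
       i + 2 := pitman_down (pitman_down ?a ?b) ?c x))"
    using pitman_at_ascending[OF p2(1) i a21] by (auto simp: e21 fun_eq_iff)
  have e212: "pitman_at (i + 1) f12 = (\<lambda>x. (f x)
      (i := pitman_up ?a (pitman_up ?b ?c) x,
       i + 1 := pitman_up (pitman_down ?a (pitman_up ?b ?c)) (pitman_down ?b ?c) x,
       i + 2 := pitman_down (pitman_down ?a (pitman_up ?b ?c)) (pitman_down ?b ?c) x))"
    using pitman_at_ascending[OF p2(2) i'] a12 by (auto simp: e12 fun_eq_iff numeral_2_eq_2)
  have ab: "ascends ?a ?b" and bc: "ascends ?b ?c"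
    using ascends_coords[OF f] idx asc by auto
  have down_ab_c: "ascends (pitman_down ?a ?b) ?c"
    using ascends_coords[OF p1(1) idx(2,3) a1] by (simp add: e1)
  have a_up_bc: "ascends ?a (pitman_up ?b ?c)"
    using ascends_coords[OF p1(2) idx(1,2) a2] by (simp add: e2)
  have up_up: "ascends (pitman_up ?a ?b) (pitman_up (pitman_down ?a ?b) ?c)"
    using ascends_coords[OF p2(1) idx(1,2) a21] by (simp add: e21)
  have down_down: "ascends (pitman_down ?a (pitman_up ?b ?c)) (pitman_down ?b ?c)"
    using ascends_coords[OF p2(2) idx(2,3) a12] by (simp add: e12)
  note top = pitman_up_braid[OF ab bc a_up_bc down_ab_c up_up]
  note bottom = pitman_down_braid[OF ab bc down_ab_c a_up_bc down_down]
  \<comment> \<open>Every transform preserves the sum of its pair, so both sides have the same sum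
    of three coordinates, and agreement of the outer two forces that of the middle one.\<close>
  have middle: "pitman_down (pitman_up ?a ?b) (pitman_up (pitman_down ?a ?b) ?c) x
      = pitman_up (pitman_down ?a (pitman_up ?b ?c)) (pitman_down ?b ?c) x" for x
    using pitman_up_add_down[of ?a ?b x] pitman_up_add_down[of ?b ?c x]
      pitman_up_add_down[of "pitman_down ?a ?b" ?c x] pitman_up_add_down[of ?a "pitman_up ?b ?c" x]
      pitman_up_add_down[of "pitman_up ?a ?b" "pitman_up (pitman_down ?a ?b) ?c" x]
      pitman_up_add_down[of "pitman_down ?a (pitman_up ?b ?c)" "pitman_down ?b ?c" x] top bottom
    by simp
  show ?thesis
    unfolding f1_def[symmetric] f21_def[symmetric] f2_def[symmetric] f12_def[symmetric] e121 e212
    by (simp only: top bottom middle)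
qed

section \<open>Sorting the slopes\<close>

definition pitman_step :: "nat \<Rightarrow> (real \<Rightarrow> nat \<Rightarrow> real) \<Rightarrow> (real \<Rightarrow> nat \<Rightarrow> real) \<Rightarrow> bool" where
  "pitman_step n f g \<longleftrightarrow>
    f \<in> paths n \<and> (\<exists>i\<in>{1..<n}. slope n f i < slope n f (i + 1) \<and> g = pitman_at i f)"

definition descending :: "nat \<Rightarrow> (real \<Rightarrow> nat \<Rightarrow> real) \<Rightarrow> bool" where
  "descending n f \<longleftrightarrow> (\<forall>i\<in>{1..<n}. slope n f (i + 1) \<le> slope n f i)"

text \<open>All pairs are counted, because a step may leave the number of neighbouring ascents
  unchanged, as from (1, 0, 2) to (1, 2, 0).\<close>

definition ascents :: "nat \<Rightarrow> (nat \<Rightarrow> real) \<Rightarrow> (nat \<times> nat) set" where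
  "ascents n l = {(a, b). a \<in> {1..n} \<and> b \<in> {1..n} \<and> a < b \<and> l a < l b}"

text \<open>The transposition carries the ascents of the new vector injectively to ascents of the
  old one and misses the pair (i, i + 1).\<close>

lemma card_ascents_swap:
  assumes i: "i \<in> {1..<n}" and asc: "l i < l (i + 1)"
  shows "card (ascents n (l(i := l (i + 1), i + 1 := l i))) < card (ascents n l)"
proof -
  let ?t = "Transposition.transpose i (i + 1)" and ?l = "l(i := l (i + 1), i + 1 := l i)"
  have l: "?l a = l (?t a)" for a by (auto simp: Transposition.transpose_def)
  have fin: "finite (ascents n l)"
    by (rule finite_subset[of _ "{1..n} \<times> {1..n}"]) (auto simp: ascents_def)
  have "inj (map_prod ?t ?t)"
    by (intro prod.inj_map) auto
  then have "card (ascents n ?l) = card (map_prod ?t ?t ` ascents n ?l)"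
    by (intro card_image[symmetric]) (auto intro: inj_on_subset)
  also have "\<dots> < card (ascents n l)"
  proof (intro psubset_card_mono fin psubsetI)
    \<comment> \<open>The excluded pair is no ascent of the new vector.\<close>
    have ord: "?t a < ?t b" if "a < b" "\<not> (a = i \<and> b = i + 1)" for a b
      using that by (auto simp: Transposition.transpose_def)
    have "?t a \<in> {1..n}" if "a \<in> {1..n}" for a
      using that i by (auto simp: Transposition.transpose_def)
    then show "map_prod ?t ?t ` ascents n ?l \<subseteq> ascents n l"
      using ord asc unfolding ascents_def l by fastforce
    \<comment> \<open>Its only preimage is (i + 1, i), whose entries are in the wrong order.\<close>
    have "(i, i + 1) \<notin> map_prod ?t ?t ` ascents n ?l"
      by (auto simp: ascents_def Transposition.transpose_def split: if_splits)
    moreover have "(i, i + 1) \<in> ascents n l"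
      using i asc by (auto simp: ascents_def)
    ultimately show "map_prod ?t ?t ` ascents n ?l \<noteq> ascents n l" by blast
  qed
  finally show ?thesis .
qed

lemma pitman_step_ascents:
  assumes "pitman_step n f g"
  shows "card (ascents n (slope n g)) < card (ascents n (slope n f))"
  using assms by (auto simp: pitman_step_def pitman_at_ascending_paths(2) card_ascents_swap[simplified])

lemma pitman_step_paths:
  assumes "pitman_step n f g"
  shows "f \<in> paths n" "g \<in> paths n"
  using assms by (auto simp: pitman_step_def pitman_at_paths)

section \<open>Existence and uniqueness of the sorted form\<close>

lemma pitman_steps_paths: "(pitman_step n)\<^sup>*\<^sup>* f g \<Longrightarrow> f \<in> paths n \<Longrightarrow> g \<in> paths n"
  by (induction rule: rtranclp_induct) (auto dest: pitman_step_paths)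

lemma pitman_steps_descending:
  assumes "(pitman_step n)\<^sup>*\<^sup>* f g" "descending n f"
  shows "g = f"
  using assms
  by (cases rule: converse_rtranclpE) (auto simp: pitman_step_def descending_def not_le[symmetric])

lemma ex_descending:
  assumes "f \<in> paths n"
  shows "\<exists>h. (pitman_step n)\<^sup>*\<^sup>* f h \<and> descending n h"
  using assms
proof (induction "card (ascents n (slope n f))" arbitrary: f rule: less_induct)
  case less
  show ?case
  proof (cases "descending n f")
    case False
    then obtain i where "i \<in> {1..<n}" "slope n f i < slope n f (i + 1)"
      by (auto simp: descending_def not_le)
    then have "pitman_step n f (pitman_at i f)"
      using less.prems by (auto simp: pitman_step_def)
    with less.hyps[OF pitman_step_ascents[OF this]] pitman_step_paths[OF this] show ?thesis
      by (meson converse_rtranclp_into_rtranclp)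
  qed auto
qed

text \<open>Two ascents at distance at least 2 survive each other's step, and commutation joins the
  results after one more step each. For neighbouring ascents the braid relation joins them after two
  more steps each.\<close>

lemma pitman_step_local_confluence:
  assumes "pitman_step n f g" "pitman_step n f g'"
  shows "\<exists>k. (pitman_step n)\<^sup>*\<^sup>* g k \<and> (pitman_step n)\<^sup>*\<^sup>* g' k"
proof -
  have f: "f \<in> paths n" using assms by (simp add: pitman_step_def)
  have step: "pitman_step n u (pitman_at i u)"
    if "u \<in> paths n" "i \<in> {1..<n}" "slope n u i < slope n u (i + 1)" for u i
    using that by (auto simp: pitman_step_def)
  have join: "\<exists>k. (pitman_step n)\<^sup>*\<^sup>* (pitman_at i f) k \<and> (pitman_step n)\<^sup>*\<^sup>* (pitman_at j f) k"
    if i: "i \<in> {1..<n}" "slope n f i < slope n f (i + 1)"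
      and j: "j \<in> {1..<n}" "slope n f j < slope n f (j + 1)" and "i < j" for i j
  proof (cases "j = i + 1")
    case False
    with \<open>i < j\<close> have "i + 1 < j" by simp
    with i j have "slope n (pitman_at j f) i < slope n (pitman_at j f) (i + 1)"
      "slope n (pitman_at i f) j < slope n (pitman_at i f) (j + 1)"
      by (auto simp: pitman_at_ascending_paths(2)[OF f])
    with i j step pitman_at_paths[OF f] pitman_at_commute[OF f i(1) j(1) \<open>i + 1 < j\<close> i(2) j(2)]
    show ?thesis by (metis r_into_rtranclp)
  next
    case True
    let ?j = "i + 1"
    have j': "?j \<in> {1..<n}" "slope n f ?j < slope n f (?j + 1)" using j True by auto
    let ?fi = "pitman_at i f" and ?fj = "pitman_at ?j f"
    let ?fij = "pitman_at ?j ?fi" and ?fji = "pitman_at i ?fj"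
    note P = pitman_at_paths
    note P1 = P[OF f i(1)] P[OF f j'(1)]
    note P2 = P[OF P1(1) j'(1)] P[OF P1(2) i(1)]
    note s1 = pitman_at_ascending_paths(2)[OF f i] pitman_at_ascending_paths(2)[OF f j']
    have a1: "slope n ?fi ?j < slope n ?fi (?j + 1)" "slope n ?fj i < slope n ?fj (i + 1)"
      using s1 i(2) j'(2) by simp_all
    note s2 = pitman_at_ascending_paths(2)[OF P1(1) j'(1) a1(1)]
      pitman_at_ascending_paths(2)[OF P1(2) i(1) a1(2)]
    have a2: "slope n ?fij i < slope n ?fij (i + 1)" "slope n ?fji ?j < slope n ?fji (?j + 1)"
      using s1 s2 i(2) j'(2) by simp_all
    have "(pitman_step n)\<^sup>*\<^sup>* ?fi (pitman_at i ?fij)"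
      using step[OF P1(1) j'(1) a1(1)] step[OF P2(1) i(1) a2(1)]
      by (meson converse_rtranclp_into_rtranclp r_into_rtranclp)
    moreover have "(pitman_step n)\<^sup>*\<^sup>* ?fj (pitman_at ?j ?fji)"
      using step[OF P1(2) i(1) a1(2)] step[OF P2(2) j'(1) a2(2)]
      by (meson converse_rtranclp_into_rtranclp r_into_rtranclp)
    moreover have "pitman_at i ?fij = pitman_at ?j ?fji"
      using j'(2) by (intro pitman_at_braid[OF f i(1) j'(1) i(2)]) (simp add: numeral_2_eq_2)
    ultimately show ?thesis using True by auto
  qed
  obtain i j where "i \<in> {1..<n}" "slope n f i < slope n f (i + 1)" "g = pitman_at i f"
    and "j \<in> {1..<n}" "slope n f j < slope n f (j + 1)" "g' = pitman_at j f"
    using assms by (auto simp: pitman_step_def)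
  with join[of i j] join[of j i] show ?thesis
    by (cases i j rule: linorder_cases) auto
qed

text \<open>Newman's lemma, by induction on the number of ascending pairs: the first steps g and g'
  towards h and h' join at some k, and a sorted form m of k equals both h and h' by the induction
  hypothesis for g and g'.\<close>

lemma descending_unique:
  assumes "(pitman_step n)\<^sup>*\<^sup>* f h" "descending n h" "(pitman_step n)\<^sup>*\<^sup>* f h'" "descending n h'"
  shows "h = h'"
  using assms
proof (induction "card (ascents n (slope n f))" arbitrary: f h h' rule: less_induct)
  case less
  show ?case
  proof (cases "descending n f")
    case True
    with less.prems pitman_steps_descending show ?thesis by metis
  next
    case False
    with less.prems obtain g g' where g: "pitman_step n f g" "(pitman_step n)\<^sup>*\<^sup>* g h"
      and g': "pitman_step n f g'" "(pitman_step n)\<^sup>*\<^sup>* g' h'"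
      by (metis converse_rtranclpE)
    from pitman_step_local_confluence[OF g(1) g'(1)] obtain k
      where k: "(pitman_step n)\<^sup>*\<^sup>* g k" "(pitman_step n)\<^sup>*\<^sup>* g' k" by blast
    have "k \<in> paths n"
      using k(1) g(1) pitman_step_paths pitman_steps_paths by blast
    from ex_descending[OF this] obtain m where m: "(pitman_step n)\<^sup>*\<^sup>* k m" "descending n m" by blast
    have "h = m"
      using pitman_step_ascents[OF g(1)] g(2) less.prems(2) rtranclp_trans[OF k(1) m(1)] m(2)
      by (rule less.hyps)
    moreover have "h' = m"
      using pitman_step_ascents[OF g'(1)] g'(2) less.prems(4) rtranclp_trans[OF k(2) m(1)] m(2)
      by (rule less.hyps)
    ultimately show ?thesis by simp
  qed
qed

text \<open>The equivalence of having the same sorted form. As it includes membership in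
  \<open>paths n\<close>, proving a path joinable also proves the closure of \<open>paths n\<close>
  under words.\<close>

definition joinable :: "nat \<Rightarrow> (real \<Rightarrow> nat \<Rightarrow> real) \<Rightarrow> (real \<Rightarrow> nat \<Rightarrow> real) \<Rightarrow> bool" where
  "joinable n f g \<longleftrightarrow> f \<in> paths n \<and> g \<in> paths n \<and>
    (\<exists>h. descending n h \<and> (pitman_step n)\<^sup>*\<^sup>* f h \<and> (pitman_step n)\<^sup>*\<^sup>* g h)"

lemma joinable_refl: "f \<in> paths n \<Longrightarrow> joinable n f f"
  using ex_descending by (auto simp: joinable_def)

lemma joinable_sym: "joinable n f g \<Longrightarrow> joinable n g f"
  by (auto simp: joinable_def)

text \<open>The common middle path has only one sorted form.\<close>

lemma joinable_trans: "joinable n f g \<Longrightarrow> joinable n g h \<Longrightarrow> joinable n f h"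
  unfolding joinable_def using descending_unique by metis

lemma pitman_step_joinable:
  assumes "pitman_step n f g"
  shows "joinable n f g"
  using assms ex_descending[OF pitman_step_paths(2)[OF assms]] pitman_step_paths[OF assms]
  unfolding joinable_def by (meson converse_rtranclp_into_rtranclp)

text \<open>Paths with equal slopes have the same ascents, so both can be sorted by the same steps,
  and each step is undone by \<open>pitman_bar_at\<close>. Descending paths are their own sorted
  forms.\<close>

lemma joinable_eq_slope:
  assumes "joinable n f g" "slope n f = slope n g"
  shows "f = g"
  using assms
proof (induction "card (ascents n (slope n f))" arbitrary: f g rule: less_induct)
  case less
  have paths: "f \<in> paths n" "g \<in> paths n" using less.prems by (auto simp: joinable_def)
  show ?case
  proof (cases "descending n f")
    case True
    then have "descending n g" using less.prems by (simp add: descending_def)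
    with True show ?thesis
      using less.prems(1) pitman_steps_descending unfolding joinable_def by metis
  next
    case False
    then obtain i where i: "i \<in> {1..<n}" and asc: "slope n f i < slope n f (i + 1)"
      by (auto simp: descending_def not_le)
    note asc' = asc[unfolded less.prems(2)]
    have steps: "pitman_step n f (pitman_at i f)" "pitman_step n g (pitman_at i g)"
      using i asc asc' paths by (auto simp: pitman_step_def)
    have "pitman_at i f = pitman_at i g"
    proof (rule less.hyps)
      show "card (ascents n (slope n (pitman_at i f))) < card (ascents n (slope n f))"
        by (rule pitman_step_ascents[OF steps(1)])
      show "joinable n (pitman_at i f) (pitman_at i g)"
        using steps[THEN pitman_step_joinable] less.prems(1) joinable_sym joinable_trans by metis
      show "slope n (pitman_at i f) = slope n (pitman_at i g)"
        unfolding slope_pitman_at[OF paths(1) i] slope_pitman_at[OF paths(2) i] less.prems(2) ..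
    qed
    then have "pitman_bar_at i (pitman_at i f) = pitman_bar_at i (pitman_at i g)"
      by (rule arg_cong)
    then show ?thesis
      unfolding pitman_bar_at_pitman_at[OF paths(1) i asc] pitman_bar_at_pitman_at[OF paths(2) i asc'] .
  qed
qed

section \<open>The generators acting on paths\<close>

lemma pitman_gen_eq:
  assumes "f \<in> paths n"
  shows "pitman_gen n (Tau i) f = pitman_at i f" "pitman_gen n (TauBar i) f = pitman_bar_at i f"
  using assms by (auto simp: pitman_bar_at_def)

lemma pitman_gen_closed:
  assumes "\<xi> \<in> gens n"
  shows "pitman_gen n \<xi> \<in> paths n \<rightarrow>\<^sub>E paths n"
proof -
  have "pitman_gen n \<xi> f \<in> paths n" if "f \<in> paths n" for f
    using assms that by (cases \<xi>) (auto simp: gens_def pitman_gen_eq pitman_at_paths pitman_bar_at_paths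
        simp del: pitman_gen.simps)
  then show ?thesis
    by (cases \<xi>) (auto simp: PiE_def extensional_def)
qed

lemma slope_pitman_gen:
  assumes "\<xi> \<in> gens n" "f \<in> paths n"
  shows "slope n (pitman_gen n \<xi> f) = basic_gen n \<xi> (slope n f)"
  using assms by (cases \<xi>) (auto simp: gens_def pitman_gen_eq slope_pitman_at slope_pitman_bar_at
      simp del: pitman_gen.simps basic_gen.simps)

text \<open>\<open>Tau i\<close> is a step at an ascent and the identity elsewhere.
  \<open>TauBar i\<close> at a descent is a step taken backwards, since \<open>pitman_at i\<close>
  leads from the result to f.\<close>

lemma pitman_gen_joinable:
  assumes "\<xi> \<in> gens n" and f: "f \<in> paths n"
  shows "joinable n (pitman_gen n \<xi> f) f"
proof -
  obtain i where i: "i \<in> {1..<n}" and \<xi>: "\<xi> = Tau i \<or> \<xi> = TauBar i"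
    using assms by (auto simp: gens_def)
  have "joinable n (pitman_at i f) f"
  proof (cases "slope n f i < slope n f (i + 1)")
    case True
    with i f have "pitman_step n f (pitman_at i f)" by (auto simp: pitman_step_def)
    then show ?thesis by (intro joinable_sym[OF pitman_step_joinable])
  qed (simp add: pitman_at_not_ascending[OF f i] joinable_refl f)
  moreover have "joinable n (pitman_bar_at i f) f"
  proof (cases "slope n f i > slope n f (i + 1)")
    case True
    with i f have "slope n (pitman_bar_at i f) i < slope n (pitman_bar_at i f) (i + 1)"
      by (simp add: slope_pitman_bar_at slope_in_Rvec)
    with i f have "pitman_step n (pitman_bar_at i f) (pitman_at i (pitman_bar_at i f))"
      by (auto simp: pitman_step_def pitman_bar_at_paths)
    then show ?thesis
      unfolding pitman_at_pitman_bar_at[OF f i True] by (rule pitman_step_joinable)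
  qed (simp add: pitman_bar_at_not_descending[OF f i] joinable_refl f)
  ultimately show ?thesis using \<xi> pitman_gen_eq[OF f] by metis
qed

section \<open>Words\<close>

lemma fun_monoid_Nil_apply: "x \<in> S \<Longrightarrow> eval_word (fun_monoid S) \<phi> [] x = x"
  by (simp add: fun_monoid_def)

lemma fun_monoid_Cons_apply:
  "x \<in> S \<Longrightarrow> eval_word (fun_monoid S) \<phi> (\<xi> # w) x = \<phi> \<xi> (eval_word (fun_monoid S) \<phi> w x)"
  by (simp add: fun_monoid_def compose_eq)

lemma eval_word_extensional: "eval_word (fun_monoid S) \<phi> w \<in> extensional S"
  by (cases w) (auto simp: fun_monoid_def)

lemma pitman_word_apply:
  assumes "w \<in> lists (gens n)" and f: "f \<in> paths n"
  shows "joinable n (pitman_word n w f) f"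
    and "slope n (pitman_word n w f) = basic_word n w (slope n f)"
  using assms(1)
proof induction
  case Nil
  show "joinable n (pitman_word n [] f) f" "slope n (pitman_word n [] f) = basic_word n [] (slope n f)"
    by (simp_all only: fun_monoid_Nil_apply f slope_in_Rvec joinable_refl)
next
  case (Cons \<xi> w)
  have p: "pitman_word n w f \<in> paths n" using Cons.IH(1) by (simp add: joinable_def)
  show "joinable n (pitman_word n (\<xi> # w) f) f"
    unfolding fun_monoid_Cons_apply[OF f]
    using pitman_gen_joinable[OF Cons.hyps(1) p] Cons.IH(1) by (rule joinable_trans)
  show "slope n (pitman_word n (\<xi> # w) f) = basic_word n (\<xi> # w) (slope n f)"
    unfolding fun_monoid_Cons_apply[OF f] fun_monoid_Cons_apply[OF slope_in_Rvec[OF f]]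
    using slope_pitman_gen[OF Cons.hyps(1) p] Cons.IH(2) by simp
qed

lemma pitman_word_closed:
  assumes "w \<in> lists (gens n)"
  shows "pitman_word n w \<in> paths n \<rightarrow>\<^sub>E paths n"
  using pitman_word_apply(1)[OF assms] eval_word_extensional by (auto simp: PiE_def joinable_def)

text \<open>Both results share the sorted form of f, and their slopes agree because the basic action
  depends only on the element of the biHecke monoid. Together these data determine a path.\<close>

lemma pitman_word_well_defined:
  assumes "v \<in> lists (gens n)" "w \<in> lists (gens n)" "biHecke_word n v = biHecke_word n w"
  shows "pitman_word n v = pitman_word n w"
proof (rule extensionalityI[OF eval_word_extensional eval_word_extensional])
  fix f assume f: "f \<in> paths n"
  note V = pitman_word_apply[OF assms(1) f] and W = pitman_word_apply[OF assms(2) f]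
  have "slope n (pitman_word n v f) = slope n (pitman_word n w f)"
    unfolding V(2) W(2) basic_word_well_defined[OF assms] ..
  then show "pitman_word n v f = pitman_word n w f"
    using joinable_eq_slope joinable_trans[OF V(1) joinable_sym[OF W(1)]] by blast
qed

section \<open>Linear paths, which realise every slope vector\<close>

lemma is_slope_linear:
  assumes "l \<in> Rvec n"
  shows "is_slope n (\<lambda>x. \<lambda>j\<in>{1..n}. x * l j) l"
proof -
  have "((\<lambda>x. x * c / x) \<longlongrightarrow> c) at_top" "((\<lambda>x. x * c / x) \<longlongrightarrow> c) at_bot" for c :: real
    by (rule tendsto_eventually, use eventually_gt_at_top[of 0] in eventually_elim, simp,
        rule tendsto_eventually, use eventually_gt_at_bot[of 0] in eventually_elim, simp)
  with assms show ?thesis by (simp add: is_slope_def)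
qed

lemma linear_paths:
  assumes "l \<in> Rvec n"
  shows "(\<lambda>x. \<lambda>j\<in>{1..n}. x * l j) \<in> paths n"
  using is_slope_linear[OF assms] by (auto simp: paths_def Rvec_def intro!: continuous_intros)

text \<open>The slopes of linear paths separate the elements of the biHecke monoid: the slope vector
  \<open>y \<circ> \<chi>\<inverse>\<close> with \<open>y\<close> strictly increasing determines \<open>\<chi>\<close>.\<close>

lemma biHecke_word_eq_if_pitman_word_eq:
  assumes v: "v \<in> lists (gens n)" and w: "w \<in> lists (gens n)"
    and eq: "pitman_word n v = pitman_word n w"
  shows "biHecke_word n v = biHecke_word n w"
proof (rule extensionalityI[OF eval_word_extensional eval_word_extensional])
  fix \<chi> assume \<chi>: "\<chi> \<in> Sym n"
  define y :: "nat \<Rightarrow> real" where "y = (\<lambda>j\<in>{1..n}. real j)"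
  have y: "y \<in> Rvec n" "\<And>i j. i \<in> {1..n} \<Longrightarrow> j \<in> {1..n} \<Longrightarrow> i \<le> j \<Longrightarrow> y i \<le> y j"
    by (auto simp: y_def Rvec_def)
  have l: "y \<circ> inv \<chi> \<in> Rvec n"
    using y(1) \<chi> permutes_not_in[OF permutes_inv]
    by (fastforce simp: Sym_def Rvec_def PiE_def extensional_def)
  \<comment> \<open>Evaluated on a linear path with this slope, equality of the path operators
    becomes equality of the basic actions.\<close>
  have "basic_word n v (y \<circ> inv \<chi>) = basic_word n w (y \<circ> inv \<chi>)"
    using pitman_word_apply(2)[OF v linear_paths[OF l]] pitman_word_apply(2)[OF w linear_paths[OF l]]
    unfolding slope_eqI[OF is_slope_linear[OF l]] eq by argo
  moreover note V = basic_word_sorted[OF v \<chi> y] and W = basic_word_sorted[OF w \<chi> y]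
  ultimately have inv_eq: "y \<circ> inv (biHecke_word n v \<chi>) = y \<circ> inv (biHecke_word n w \<chi>)" by simp
  have pv: "inv (biHecke_word n v \<chi>) permutes {1..n}" and pw: "inv (biHecke_word n w \<chi>) permutes {1..n}"
    using V W by (auto simp: Sym_def permutes_inv)
  have "inv (biHecke_word n v \<chi>) j = inv (biHecke_word n w \<chi>) j" for j
  proof (cases "j \<in> {1..n}")
    case True
    then have "inv (biHecke_word n v \<chi>) j \<in> {1..n}" "inv (biHecke_word n w \<chi>) j \<in> {1..n}"
      using permutes_in_image[OF pv] permutes_in_image[OF pw] by auto
    with fun_cong[OF inv_eq, of j] show ?thesis by (simp add: y_def)
  next
    case False
    then show ?thesis by (simp add: permutes_not_in[OF pv] permutes_not_in[OF pw])
  qed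
  then have "inv (biHecke_word n v \<chi>) = inv (biHecke_word n w \<chi>)" by blast
  then show "biHecke_word n v \<chi> = biHecke_word n w \<chi>"
    using V W by (metis (mono_tags, lifting) Sym_def mem_Collect_eq permutes_inv_inv)
qed

section \<open>The monoid isomorphism\<close>

lemma eval_word_append:
  assumes "monoid G" "\<phi> ` S \<subseteq> carrier G" "v \<in> lists S" "w \<in> lists S"
  shows "eval_word G \<phi> (v @ w) = eval_word G \<phi> v \<otimes>\<^bsub>G\<^esub> eval_word G \<phi> w"
proof -
  interpret monoid G by fact
  have closed: "eval_word G \<phi> u \<in> carrier G" if "u \<in> lists S" for u
    using that by induction (use assms(2) in auto)
  from assms(3) show ?thesis
  proof induction
    case (Cons s v)
    then have "\<phi> s \<in> carrier G" using assms(2) by auto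
    with Cons closed[OF assms(4)] closed[OF Cons.hyps(2)] show ?case by (simp add: m_assoc)
  qed (use closed[OF assms(4)] in simp)
qed

lemma biHecke_gens_carrier: "biHecke_gen n ` gens n \<subseteq> carrier (fun_monoid (Sym n))"
  and pitman_gens_carrier: "pitman_gen n ` gens n \<subseteq> carrier (fun_monoid (paths n))"
  by (simp_all add: fun_monoid_def image_subset_iff biHecke_gen_closed pitman_gen_closed)

lemma Pitman_monoid_carrier: "carrier (Pitman_monoid n) = pitman_word n ` lists (gens n)"
  using gen_submonoid_words[OF monoid_fun_monoid pitman_gens_carrier] by (simp add: Pitman_monoid_def)

text \<open>Well-definedness removes the arbitrary choice made in \<open>word_of\<close>: any word
  for the element may be used instead.\<close>

lemma Pitman_biHecke_word:
  assumes "w \<in> lists (gens n)"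
  shows "Pitman n (biHecke_word n w) = pitman_word n w"
proof -
  have "biHecke_word n w \<in> carrier (biHecke n)"
    using assms by (simp add: biHecke_carrier)
  from word_of[OF this] assms show ?thesis
    unfolding Pitman_def by (intro pitman_word_well_defined)
qed

text \<open>Concatenation of words represents the product in both monoids.\<close>

lemma Pitman_mult:
  assumes "\<sigma> \<in> carrier (biHecke n)" "\<rho> \<in> carrier (biHecke n)"
  shows "Pitman n (\<sigma> \<otimes>\<^bsub>biHecke n\<^esub> \<rho>) = Pitman n \<sigma> \<otimes>\<^bsub>Pitman_monoid n\<^esub> Pitman n \<rho>"
proof -
  obtain v w where v: "v \<in> lists (gens n)" "\<sigma> = biHecke_word n v"
    and w: "w \<in> lists (gens n)" "\<rho> = biHecke_word n w"
    using assms unfolding biHecke_carrier by blast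
  have vw: "v @ w \<in> lists (gens n)" using v w by simp
  have "\<sigma> \<otimes>\<^bsub>biHecke n\<^esub> \<rho> = biHecke_word n (v @ w)"
    by (simp add: biHecke_def v(2) w(2) eval_word_append[OF monoid_fun_monoid biHecke_gens_carrier v(1) w(1)])
  then have "Pitman n (\<sigma> \<otimes>\<^bsub>biHecke n\<^esub> \<rho>) = pitman_word n (v @ w)"
    using Pitman_biHecke_word[OF vw] by simp
  also have "\<dots> = pitman_word n v \<otimes>\<^bsub>Pitman_monoid n\<^esub> pitman_word n w"
    by (simp add: Pitman_monoid_def eval_word_append[OF monoid_fun_monoid pitman_gens_carrier v(1) w(1)])
  finally show ?thesis by (simp only: v w Pitman_biHecke_word)
qed

lemma Pitman_iso: "Pitman n \<in> iso (biHecke n) (Pitman_monoid n)"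
proof -
  have "inj_on (Pitman n) (carrier (biHecke n))"
    unfolding biHecke_carrier
  proof (rule inj_onI, elim imageE)
    fix \<sigma> \<rho> v w
    assume "Pitman n \<sigma> = Pitman n \<rho>" "v \<in> lists (gens n)" "w \<in> lists (gens n)"
      "\<sigma> = biHecke_word n v" "\<rho> = biHecke_word n w"
    then show "\<sigma> = \<rho>"
      using biHecke_word_eq_if_pitman_word_eq[of v n w] by (metis Pitman_biHecke_word)
  qed
  moreover have surj: "Pitman n ` carrier (biHecke n) = carrier (Pitman_monoid n)"
    unfolding biHecke_carrier Pitman_monoid_carrier image_image
    by (rule image_cong[OF refl Pitman_biHecke_word])
  moreover have "Pitman n \<in> hom (biHecke n) (Pitman_monoid n)"
    using surj Pitman_mult by (intro homI) blast+
  ultimately show ?thesis by (simp add: iso_def bij_betw_def)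
qed

theorem corollary4p5:
  fixes n :: nat
  shows "(\<forall>w\<in>lists (gens n). pitman_word n w \<in> paths n \<rightarrow>\<^sub>E paths n)
    \<and> (\<forall>v\<in>lists (gens n). \<forall>w\<in>lists (gens n).
         biHecke_word n v = biHecke_word n w \<longrightarrow> pitman_word n v = pitman_word n w)
    \<and> Pitman n \<in> iso (biHecke n) (Pitman_monoid n)
    \<and> Pitman n \<one>\<^bsub>biHecke n\<^esub> = \<one>\<^bsub>Pitman_monoid n\<^esub>
    \<and> (\<forall>\<sigma>\<in>carrier (biHecke n). \<forall>f\<in>paths n.
         slope n (Pitman n \<sigma> f) = basic_action n \<sigma> (slope n f))"
proof (intro conjI ballI impI)
  \<comment> \<open>Both units are values of the empty word.\<close>
  show "Pitman n \<one>\<^bsub>biHecke n\<^esub> = \<one>\<^bsub>Pitman_monoid n\<^esub>"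
    using Pitman_biHecke_word[of "[]" n] by (simp add: biHecke_def Pitman_monoid_def)
  show "slope n (Pitman n \<sigma> f) = basic_action n \<sigma> (slope n f)"
    if "\<sigma> \<in> carrier (biHecke n)" "f \<in> paths n" for \<sigma> f
    unfolding Pitman_def basic_action_def
    using word_of(1)[OF that(1)] that(2) by (rule pitman_word_apply(2))
qed (fact pitman_word_closed pitman_word_well_defined Pitman_iso)+

end
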